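(* Let $(T,F)$ be a rooted tree with a sink over $(Q,\rho)$ and let $M:=M(T,F)$ be the associated rooted tree module. The following are equivalent: (1) $M$ is indecomposable; (2) there is no non-identity idempotent quiver morphism $\iota:T\to T$ satisfying $F\circ\iota=F$; (3) there does not exist a generalized graph map $\mathcal M=(\mathcal M_0,\mathcal M_1,\mathcal E_{\mathcal M})$ from $M$ to itself with some $(n_1,n_2)\in\pi(\mathcal M_0)$ satisfying $n_1\neq n_2$, $\mathsf p(n_1)=\mathsf p(n_2)$ and $F(a_{n_1})=F(a_{n_2})$.
   Context: Fix a field $\mathcal K$ with $\mathrm{char}(\mathcal K)\neq 2$. Let $Q=(Q_0,Q_1,\varsigma,\varepsilon)$ be a quiver and $\rho$ a set of paths in $Q$ of length at least $2$ that bounds the length of the paths, not lying in the ideal $\langle\rho\rangle$, passing through any vertex. Put $\Lambda:=\mathcal KQ/\langle\rho\rangle$. Finite-dimensional $\Lambda$-modules are identified with finite-dimensional $\mathcal K$-representations of $(Q,\rho)$. A tree is a finite quiver $T=(T_0,T_1,s,t)$ whose underlying undirected graph is connected without cycles. Here rooted trees have a unique sink $\ast$ (the root). For $n\in T_0\setminus\{\ast\}$ there is a unique arrow with source $n$, denoted $a_n$; its target is the parent $\mathsf p(n)$. A quiver morphism is a pair of maps (on vertices and on arrows) commuting with sources and targets. A quiver morphism $F:T\to Q$ is bound, written $F:T\to(Q,\rho)$, if there is no path $p$ in $T$ with $F(p)\in\langle\rho\rangle$; then $(T,F)$ is a tree over $(Q,\rho)$. The rooted tree module (RTM) $M(T,F)$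 has $\mathcal K$-basis $\{v_n\mid n\in T_0\}$, with $v_n$ at the vertex $F(n)$, and $\gamma\in Q_1$ acts by $\gamma\cdot v_n=\sum_{a\in T_1,\ s(a)=n,\ F(a)=\gamma}v_{t(a)}$. Let $(T^1,F_1),(T^2,F_2)$ be rooted trees with sinks over $(Q,\rho)$, $M_j=M(T^j,F_j)$; in $T^2$ the arrow with source $m$ is written $b_m$. (For GGMs from $M$ to itself take both equal to $(T,F)$, with $b_m=a_m$.) Networks. A network consists of a quiver together with a set of undirected edges forming a simple graph on the same vertex set. The pullback network $\mathcal N[1]$ has vertices $\mathcal N[1]_0=\{(n,m)\in T^1_0\times T^2_0\mid F_1(n)=F_2(m)\}$; arrows $\mathcal N[1]_1$: $(a_n,b_m):(n,m)\to(\mathsf p(n),\mathsf p(m))$ whenever $F_1(a_n)=F_2(b_m)$; edges $\mathcal E^1=\{\{(n,m),(n,m')\}\mid m\ne m',\ \mathsf p(m)=\mathsf p(m'),\ F_2(b_m)=F_2(b_{m'})\}$. The 2-covering network $\mathcal N[2]$ has $\mathcal N[2]_l=\mathcal N[1]_l\times\{-1,1\}$ for $l=0,1$ (sources and targets keep the sign) and edges $\mathcal E^2=\{\{(n,m,i),(n,m',-i)\}\mid\{(n,m),(n,m')\}\in\mathcal E^1,\ i\in\{-1,1\}\}$; $\pi:\mathcal N[2]\to\mathcal N[1]$ forgets the sign. A link is an arrow, a formal inverse of an arrow, or an edge. A traversal is a walk along links containing no $\alpha\alpha^{-1}$ as a subwalk (with $(\alpha^{-1})^{-1}=\alpha$ for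 an arrow and $\alpha^{-1}=\alpha$ for an edge); vertices are traversals of length $0$. A triangle in $\mathcal N[1]$ is an induced subnetwork on three vertices whose total number of arrows and edges is $3$. $\mathcal R[1]$ is the set of length-two traversals in $\mathcal N[1]$ through three vertices inducing a triangle, and $\mathcal R[2]$ is the set of traversals $\mathfrak t$ in $\mathcal N[2]$ with $\pi(\mathfrak t)\in\mathcal R[1]$. A subnetwork $\mathcal M=(\mathcal M_0,\mathcal M_1,\mathcal E_{\mathcal M})$ of $\mathcal N[2]$ is: $\mathcal R[2]$-free if no traversal in $\mathcal M$ lies in $\mathcal R[2]$; involution-free if $(n,m,j)\in\mathcal M_0$ implies $(n,m,-j)\notin\mathcal M_0$; connected if there is a traversal in $\mathcal M$ between any two of its vertices; complete if for each $(n,m,j)\in\mathcal M_0$: (i) for every arrow $a_{n'}:n'\to n$ in $T^1$ there is an arrow $b_{m'}:m'\to m$ in $T^2$ such that the arrow $(a_{n'},b_{m'},j):(n',m',j)\to(n,m,j)$ is in $\mathcal M_1$; (ii) if there is an arrow $b_m:m\to m'$ in $T^2$, then at least one of the following holds: there is an arrow $a_n:n\to n'$ in $T^1$ with $(a_n,b_m,j)\in\mathcal M_1$; or there is $b_{m''}:m''\to m'$ in $T^2$ with $F_2(b_m)=F_2(b_{m''})$, $(n,m'',-j)\in\mathcal M_0$ and $\{(n,m,j),(n,m'',-j)\}\in\mathcal E_{\mathcal M}$. A generalized graph map (GGM) from $M_1$ to $M_2$ is a non-empty, complete, connected, $\mathcal R[2]$-free and involution-free subnetwork of $\mathcal N[2]$.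 *)

theory Defs
  imports
    "Graph_Theory.Digraph_Component"
    "HOL-Library.Poly_Mapping"
begin

section \<open>Quivers, rooted trees and quiver morphisms\<close>

text \<open>
  A quiver is a \<^const>\<open>wf_digraph\<close>; loops, parallel arrows and infinite quivers are allowed. A path is
  stored as its start vertex together with its arrows in the order in which they are traversed, so
  that the trivial path at \<open>x\<close> is \<open>(x, [])\<close>.
\<close>

type_synonym ('v, 'e) qpath = "'v \<times> 'e list"

definition paths :: "('v, 'e) pre_digraph \<Rightarrow> ('v, 'e) qpath set" where
  "paths Q = {(u, p). \<exists>v. pre_digraph.awalk Q u p v}"

definition path_verts :: "('v, 'e) pre_digraph \<Rightarrow> ('v, 'e) qpath \<Rightarrow> 'v list" where
  "path_verts Q p = pre_digraph.awalk_verts Q (fst p) (snd p)"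

record ('n, 'a, 'v, 'e) quiver_map =
  vmap :: "'n \<Rightarrow> 'v"
  amap :: "'a \<Rightarrow> 'e"

definition quiver_morphism ::
  "('n, 'a) pre_digraph \<Rightarrow> ('v, 'e) pre_digraph \<Rightarrow> ('n, 'a, 'v, 'e) quiver_map \<Rightarrow> bool" where
  "quiver_morphism T Q F \<longleftrightarrow>
     (\<forall>n\<in>verts T. vmap F n \<in> verts Q) \<and>
     (\<forall>a\<in>arcs T. amap F a \<in> arcs Q \<and>
        tail Q (amap F a) = vmap F (tail T a) \<and> head Q (amap F a) = vmap F (head T a))"

definition qcomp ::
  "('v, 'e, 'w, 'f) quiver_map \<Rightarrow> ('n, 'a, 'v, 'e) quiver_map \<Rightarrow> ('n, 'a, 'w, 'f) quiver_map" where
  "qcomp G F = \<lparr>vmap = vmap G \<circ> vmap F, amap = amap G \<circ> amap F\<rparr>"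

definition qid :: "('n, 'a, 'n, 'a) quiver_map" where
  "qid = \<lparr>vmap = id, amap = id\<rparr>"

text \<open>
  Equality of morphisms out of \<open>T\<close>: the values of the maps outside the vertices and arrows of \<open>T\<close>
  are immaterial.
\<close>

definition qeq ::
  "('n, 'a) pre_digraph \<Rightarrow> ('n, 'a, 'v, 'e) quiver_map \<Rightarrow> ('n, 'a, 'v, 'e) quiver_map \<Rightarrow> bool" where
  "qeq T F G \<longleftrightarrow> (\<forall>n\<in>verts T. vmap F n = vmap G n) \<and> (\<forall>a\<in>arcs T. amap F a = amap G a)"

definition map_path :: "('n, 'a, 'v, 'e) quiver_map \<Rightarrow> ('n, 'a) qpath \<Rightarrow> ('v, 'e) qpath" where
  "map_path F p = (vmap F (fst p), map (amap F) (snd p))"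


section \<open>Networks, walks and traversals\<close>

record ('w, 'b) network =
  quiver :: "('w, 'b) pre_digraph"
  edges :: "'w set set"

definition wf_network :: "('w, 'b) network \<Rightarrow> bool" where
  "wf_network N \<longleftrightarrow> wf_digraph (quiver N) \<and> (\<forall>e\<in>edges N. e \<subseteq> verts (quiver N) \<and> card e = 2)"

text \<open>\<^const>\<open>subgraph\<close> includes that source and target maps agree.\<close>

definition subnetwork :: "('w, 'b) network \<Rightarrow> ('w, 'b) network \<Rightarrow> bool" where
  "subnetwork M N \<longleftrightarrow> wf_network M \<and> subgraph (quiver M) (quiver N) \<and> edges M \<subseteq> edges N"

datatype ('w, 'b) link = Arr 'b | Inv 'b | Edge "'w set"

fun link_inv :: "('w, 'b) link \<Rightarrow> ('w, 'b) link" where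
  "link_inv (Arr b) = Inv b"
| "link_inv (Inv b) = Arr b"
| "link_inv (Edge e) = Edge e"

fun step :: "('w, 'b) network \<Rightarrow> 'w \<Rightarrow> ('w, 'b) link \<Rightarrow> 'w \<Rightarrow> bool" where
  "step N u (Arr b) w \<longleftrightarrow> b \<in> arcs (quiver N) \<and> tail (quiver N) b = u \<and> head (quiver N) b = w"
| "step N u (Inv b) w \<longleftrightarrow> b \<in> arcs (quiver N) \<and> head (quiver N) b = u \<and> tail (quiver N) b = w"
| "step N u (Edge e) w \<longleftrightarrow> e \<in> edges N \<and> e = {u, w}"

text \<open>A walk is stored as the list of the vertices visited together with the list of the links used.\<close>

definition walk :: "('w, 'b) network \<Rightarrow> 'w list \<times> ('w, 'b) link list \<Rightarrow> bool" where
  "walk N = (\<lambda>(xs, ls). length xs = Suc (length ls) \<and> set xs \<subseteq> verts (quiver N) \<and>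
     (\<forall>i<length ls. step N (xs ! i) (ls ! i) (xs ! Suc i)))"

definition traversal :: "('w, 'b) network \<Rightarrow> 'w list \<times> ('w, 'b) link list \<Rightarrow> bool" where
  "traversal N t \<longleftrightarrow> walk N t \<and>
     (\<forall>i. Suc i < length (snd t) \<longrightarrow> snd t ! Suc i \<noteq> link_inv (snd t ! i))"

definition network_connected :: "('w, 'b) network \<Rightarrow> bool" where
  "network_connected N \<longleftrightarrow> (\<forall>u\<in>verts (quiver N). \<forall>v\<in>verts (quiver N).
     \<exists>t. traversal N t \<and> hd (fst t) = u \<and> last (fst t) = v)"

text \<open>Triangles are given by the vertex set of the induced subnetwork.\<close>

definition triangle :: "('w, 'b) network \<Rightarrow> 'w set \<Rightarrow> bool" where
  "triangle N S \<longleftrightarrow> S \<subseteq> verts (quiver N) \<and> card S = 3 \<and>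
     card {b \<in> arcs (quiver N). tail (quiver N) b \<in> S \<and> head (quiver N) b \<in> S} +
     card {e \<in> edges N. e \<subseteq> S} = 3"


section \<open>Rooted trees\<close>

text \<open>
  Undirected cycles of a quiver, i.e. closed walks of positive length along arrows and inverse arrows
  without repeated vertices or arrows. Loops and pairs of parallel arrows are cycles.
  (The constant \<^const>\<open>forest\<close> only excludes directed cycles.)
\<close>

fun link_arc :: "('w, 'b) link \<Rightarrow> 'b" where
  "link_arc (Arr b) = b"
| "link_arc (Inv b) = b"
| "link_arc (Edge e) = undefined"

definition undirected_cycle :: "('w, 'b) pre_digraph \<Rightarrow> 'w list \<times> ('w, 'b) link list \<Rightarrow> bool" where
  "undirected_cycle T = (\<lambda>(xs, ls). walk \<lparr>quiver = T, edges = {}\<rparr> (xs, ls) \<and> ls \<noteq> [] \<and>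
     hd xs = last xs \<and> distinct (tl xs) \<and> distinct (map link_arc ls))"

text \<open>\<^const>\<open>connected\<close> is connectedness of the underlying undirected graph; it excludes the empty quiver.\<close>

definition tree_quiver :: "('n, 'a) pre_digraph \<Rightarrow> bool" where
  "tree_quiver T \<longleftrightarrow> fin_digraph T \<and> connected T \<and> (\<nexists>c. undirected_cycle T c)"

definition sink :: "('n, 'a) pre_digraph \<Rightarrow> 'n \<Rightarrow> bool" where
  "sink T r \<longleftrightarrow> r \<in> verts T \<and> out_arcs T r = {}"

definition rooted_tree :: "('n, 'a) pre_digraph \<Rightarrow> bool" where
  "rooted_tree T \<longleftrightarrow> tree_quiver T \<and> (\<exists>!r. sink T r)"

definition tree_root :: "('n, 'a) pre_digraph \<Rightarrow> 'n" where
  "tree_root T = (THE r. sink T r)"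

text \<open>The arrow \<open>a\<^sub>n\<close> and the parent \<open>p(n)\<close>; meaningful only for non-root vertices \<open>n\<close>.\<close>

definition out_arc :: "('n, 'a) pre_digraph \<Rightarrow> 'n \<Rightarrow> 'a" where
  "out_arc T n = (THE a. a \<in> arcs T \<and> tail T a = n)"

definition parent :: "('n, 'a) pre_digraph \<Rightarrow> 'n \<Rightarrow> 'n" where
  "parent T n = head T (out_arc T n)"


section \<open>Path algebras and bound quivers\<close>

definition pm_scale :: "'k::field \<Rightarrow> ('i \<Rightarrow>\<^sub>0 'k) \<Rightarrow> ('i \<Rightarrow>\<^sub>0 'k)" where
  "pm_scale c f = Poly_Mapping.map ((*) c) f"

definition path_algebra :: "('v, 'e) pre_digraph \<Rightarrow> (('v, 'e) qpath \<Rightarrow>\<^sub>0 'k::field) set" where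
  "path_algebra Q = {x. Poly_Mapping.keys x \<subseteq> paths Q}"

text \<open>The product \<open>pq\<close> of two paths is \<open>q\<close> followed by \<open>p\<close>, and \<open>0\<close> if they cannot be concatenated.\<close>

definition path_mult ::
  "('v, 'e) pre_digraph \<Rightarrow> (('v, 'e) qpath \<Rightarrow>\<^sub>0 'k::field) \<Rightarrow> (('v, 'e) qpath \<Rightarrow>\<^sub>0 'k) \<Rightarrow>
   (('v, 'e) qpath \<Rightarrow>\<^sub>0 'k)" where
  "path_mult Q x y = (\<Sum>p\<in>Poly_Mapping.keys x. \<Sum>q\<in>Poly_Mapping.keys y.
     if last (path_verts Q q) = fst p
     then Poly_Mapping.single (fst q, snd q @ snd p)
            (Poly_Mapping.lookup x p * Poly_Mapping.lookup y q)
     else 0)"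

definition two_sided_ideal ::
  "('v, 'e) pre_digraph \<Rightarrow> (('v, 'e) qpath \<Rightarrow>\<^sub>0 'k::field) set \<Rightarrow> bool" where
  "two_sided_ideal Q I \<longleftrightarrow> I \<subseteq> path_algebra Q \<and> module.subspace pm_scale I \<and>
     (\<forall>x\<in>I. \<forall>y\<in>path_algebra Q. path_mult Q x y \<in> I \<and> path_mult Q y x \<in> I)"

definition ideal_of ::
  "('v, 'e) pre_digraph \<Rightarrow> ('v, 'e) qpath set \<Rightarrow> (('v, 'e) qpath \<Rightarrow>\<^sub>0 'k::field) set" where
  "ideal_of Q \<rho> = \<Inter>{I. two_sided_ideal Q I \<and> (\<forall>p\<in>\<rho>. Poly_Mapping.single p 1 \<in> I)}"

definition path_in_ideal ::
  "'k::field itself \<Rightarrow> ('v, 'e) pre_digraph \<Rightarrow> ('v, 'e) qpath set \<Rightarrow> ('v, 'e) qpath \<Rightarrow> bool" where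
  "path_in_ideal K Q \<rho> p \<longleftrightarrow> Poly_Mapping.single p (1::'k) \<in> ideal_of Q \<rho>"

text \<open>The bound on the lengths of the paths may depend on the vertex \<open>x\<close>.\<close>

definition bound_quiver ::
  "'k::field itself \<Rightarrow> ('v, 'e) pre_digraph \<Rightarrow> ('v, 'e) qpath set \<Rightarrow> bool" where
  "bound_quiver K Q \<rho> \<longleftrightarrow> wf_digraph Q \<and> \<rho> \<subseteq> paths Q \<and> (\<forall>p\<in>\<rho>. 2 \<le> length (snd p)) \<and>
     (\<forall>x\<in>verts Q. \<exists>B. \<forall>p\<in>paths Q.
        x \<in> set (path_verts Q p) \<and> \<not> path_in_ideal K Q \<rho> p \<longrightarrow> length (snd p) \<le> B)"

definition bound_morphism ::
  "'k::field itself \<Rightarrow> ('n, 'a) pre_digraph \<Rightarrow> ('v, 'e) pre_digraph \<Rightarrow> ('v, 'e) qpath set \<Rightarrow>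
   ('n, 'a, 'v, 'e) quiver_map \<Rightarrow> bool" where
  "bound_morphism K T Q \<rho> F \<longleftrightarrow> quiver_morphism T Q F \<and>
     (\<forall>p\<in>paths T. \<not> path_in_ideal K Q \<rho> (map_path F p))"


section \<open>Representations of bound quivers\<close>

text \<open>The vector spaces at the vertices are subspaces of one common ambient space \<open>'m\<close>.\<close>

record ('k, 'm, 'v, 'e) rep =
  scale :: "'k \<Rightarrow> 'm \<Rightarrow> 'm"
  space :: "'v \<Rightarrow> 'm set"
  act :: "'e \<Rightarrow> 'm \<Rightarrow> 'm"

definition quiver_rep ::
  "('v, 'e) pre_digraph \<Rightarrow> ('v, 'e) qpath set \<Rightarrow>
   ('k::field, 'm::ab_group_add, 'v, 'e) rep \<Rightarrow> bool" where
  "quiver_rep Q \<rho> M \<longleftrightarrow> vector_space (scale M) \<and>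
     (\<forall>x\<in>verts Q. module.subspace (scale M) (space M x)) \<and>
     (\<forall>\<gamma>\<in>arcs Q.
        (\<forall>m\<in>space M (tail Q \<gamma>). act M \<gamma> m \<in> space M (head Q \<gamma>)) \<and>
        (\<forall>m\<in>space M (tail Q \<gamma>). \<forall>m'\<in>space M (tail Q \<gamma>).
            act M \<gamma> (m + m') = act M \<gamma> m + act M \<gamma> m') \<and>
        (\<forall>c. \<forall>m\<in>space M (tail Q \<gamma>). act M \<gamma> (scale M c m) = scale M c (act M \<gamma> m))) \<and>
     (\<forall>(x, p)\<in>\<rho>. \<forall>m\<in>space M x. fold (act M) p m = 0)"

definition findim_rep ::
  "('v, 'e) pre_digraph \<Rightarrow> ('k::field, 'm::ab_group_add, 'v, 'e) rep \<Rightarrow> bool" where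
  "findim_rep Q M \<longleftrightarrow> finite {x \<in> verts Q. space M x \<noteq> {0}} \<and>
     (\<forall>x\<in>verts Q. \<exists>B. finite B \<and> space M x = module.span (scale M) B)"

definition subrep ::
  "('v, 'e) pre_digraph \<Rightarrow> ('k::field, 'm::ab_group_add, 'v, 'e) rep \<Rightarrow> ('v \<Rightarrow> 'm set) \<Rightarrow> bool" where
  "subrep Q M U \<longleftrightarrow>
     (\<forall>x\<in>verts Q. U x \<subseteq> space M x \<and> module.subspace (scale M) (U x)) \<and>
     (\<forall>\<gamma>\<in>arcs Q. \<forall>m\<in>U (tail Q \<gamma>). act M \<gamma> m \<in> U (head Q \<gamma>))"

definition nonzero_family :: "('v, 'e) pre_digraph \<Rightarrow> ('v \<Rightarrow> 'm::zero set) \<Rightarrow> bool" where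
  "nonzero_family Q U \<longleftrightarrow> (\<exists>x\<in>verts Q. U x \<noteq> {0})"

definition direct_sum ::
  "('v, 'e) pre_digraph \<Rightarrow> ('k, 'm::ab_group_add, 'v, 'e) rep \<Rightarrow>
   ('v \<Rightarrow> 'm set) \<Rightarrow> ('v \<Rightarrow> 'm set) \<Rightarrow> bool" where
  "direct_sum Q M U W \<longleftrightarrow>
     (\<forall>x\<in>verts Q. U x \<inter> W x = {0} \<and> space M x = {u + w |u w. u \<in> U x \<and> w \<in> W x})"

definition indecomposable ::
  "('v, 'e) pre_digraph \<Rightarrow> ('k::field, 'm::ab_group_add, 'v, 'e) rep \<Rightarrow> bool" where
  "indecomposable Q M \<longleftrightarrow> nonzero_family Q (space M) \<and>
     \<not> (\<exists>U W. subrep Q M U \<and> subrep Q M W \<and> direct_sum Q M U W \<and>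
            nonzero_family Q U \<and> nonzero_family Q W)"


section \<open>Rooted tree modules\<close>

text \<open>The basis vector \<open>v\<^sub>n\<close> is \<open>Poly_Mapping.single n 1\<close>; the action of \<open>\<gamma>\<close> is extended linearly.\<close>

definition rtm ::
  "('n, 'a) pre_digraph \<Rightarrow> ('n, 'a, 'v, 'e) quiver_map \<Rightarrow> ('k::field, 'n \<Rightarrow>\<^sub>0 'k, 'v, 'e) rep" where
  "rtm T F = \<lparr>
     scale = pm_scale,
     space = (\<lambda>x. module.span pm_scale
                    {Poly_Mapping.single n 1 |n. n \<in> verts T \<and> vmap F n = x}),
     act = (\<lambda>\<gamma> f. \<Sum>n\<in>Poly_Mapping.keys f. pm_scale (Poly_Mapping.lookup f n)
              (\<Sum>a\<in>{a \<in> arcs T. tail T a = n \<and> amap F a = \<gamma>}. Poly_Mapping.single (head T a) 1))\<rparr>"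

lemma lookup_pm_scale [simp]:
  "Poly_Mapping.lookup (pm_scale c f) i = c * Poly_Mapping.lookup f i"
  by (simp add: pm_scale_def Poly_Mapping.map.rep_eq when_def)

lemma vector_space_pm_scale: "vector_space (pm_scale :: 'k::field \<Rightarrow> ('i \<Rightarrow>\<^sub>0 'k) \<Rightarrow> _)"
  by (standard; rule poly_mapping_eqI) (simp_all add: lookup_add algebra_simps)

lemma module_pm_scale: "module (pm_scale :: 'k::field \<Rightarrow> ('i \<Rightarrow>\<^sub>0 'k) \<Rightarrow> _)"
  using vector_space_pm_scale by (simp add: vector_space_def module_def)

lemma keys_span:
  assumes "f \<in> module.span pm_scale {Poly_Mapping.single n (1::'k::field) |n. n \<in> S}"
  shows "Poly_Mapping.keys f \<subseteq> S"
proof -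
  interpret module "pm_scale :: 'k \<Rightarrow> ('a \<Rightarrow>\<^sub>0 'k) \<Rightarrow> _" by (rule module_pm_scale)
  have sub: "subspace {f :: 'a \<Rightarrow>\<^sub>0 'k. Poly_Mapping.keys f \<subseteq> S}"
    by (rule subspaceI) (auto simp: in_keys_iff lookup_add subset_iff, metis add_0)
  have "span {Poly_Mapping.single n (1::'k) |n. n \<in> S} \<subseteq> {f. Poly_Mapping.keys f \<subseteq> S}"
    by (rule span_minimal[OF _ sub]) auto
  with assms show ?thesis by blast
qed

lemma act_rtm_superset:
  fixes f :: "'n \<Rightarrow>\<^sub>0 'k::field"
  assumes "finite S" "Poly_Mapping.keys f \<subseteq> S"
  shows "act (rtm T F) \<gamma> f = (\<Sum>n\<in>S. pm_scale (Poly_Mapping.lookup f n)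
     (\<Sum>a\<in>{a \<in> arcs T. tail T a = n \<and> amap F a = \<gamma>}. Poly_Mapping.single (head T a) 1))"
proof -
  interpret module "pm_scale :: 'k \<Rightarrow> ('n \<Rightarrow>\<^sub>0 'k) \<Rightarrow> _" by (rule module_pm_scale)
  show ?thesis unfolding rtm_def rep.simps
    by (rule sum.mono_neutral_left[OF assms]) (simp add: in_keys_iff)
qed

lemma keys_act_rtm:
  assumes "i \<in> Poly_Mapping.keys (act (rtm T F :: ('k::field, _, _, _) rep) \<gamma> f)"
  obtains a where "a \<in> arcs T" "tail T a \<in> Poly_Mapping.keys f" "amap F a = \<gamma>" "head T a = i"
proof -
  have "(\<Sum>n\<in>Poly_Mapping.keys f. Poly_Mapping.lookup f n * (\<Sum>a\<in>{a \<in> arcs T. tail T a = n \<and> amap F a = \<gamma>}.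
     Poly_Mapping.lookup (Poly_Mapping.single (head T a) 1) i)) \<noteq> 0"
    using assms by (simp add: rtm_def in_keys_iff lookup_sum)
  then obtain n where n: "n \<in> Poly_Mapping.keys f" and
    nz: "(\<Sum>a\<in>{a \<in> arcs T. tail T a = n \<and> amap F a = \<gamma>}.
     Poly_Mapping.lookup (Poly_Mapping.single (head T a) (1::'k)) i) \<noteq> 0"
    by (rule sum.not_neutral_contains_not_neutral) auto
  from nz obtain a where "a \<in> arcs T" "tail T a = n" "amap F a = \<gamma>"
    "Poly_Mapping.lookup (Poly_Mapping.single (head T a) (1::'k)) i \<noteq> 0"
    by (rule sum.not_neutral_contains_not_neutral) auto
  with n that show thesis by (auto simp: lookup_single when_def split: if_splits)
qed

lemma fold_act_rtm_nonzero:
  assumes "wf_digraph T" "Poly_Mapping.keys f \<subseteq> verts T"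
    "fold (act (rtm T F :: ('k::field, _, _, _) rep)) p f \<noteq> 0"
  shows "\<exists>n\<in>Poly_Mapping.keys f. \<exists>q. (n, q) \<in> paths T \<and> map (amap F) q = p"
  using assms(2,3)
proof (induction p arbitrary: f)
  case Nil
  then obtain n where "n \<in> Poly_Mapping.keys f"
    by (auto simp: poly_mapping_eq_iff in_keys_iff fun_eq_iff)
  with Nil show ?case
    by (intro bexI[of _ n] exI[of _ "[]"]) (auto simp: paths_def pre_digraph.awalk_def pre_digraph.cas.simps)
next
  case (Cons \<gamma> p)
  let ?g = "act (rtm T F :: ('k, _, _, _) rep) \<gamma> f"
  have "Poly_Mapping.keys ?g \<subseteq> verts T"
    using assms(1) by (auto elim!: keys_act_rtm intro: wf_digraph.head_in_verts)
  from Cons.IH[OF this] Cons.prems(2) obtain n q where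
    n: "n \<in> Poly_Mapping.keys ?g" "(n, q) \<in> paths T" "map (amap F) q = p" by auto
  from n(1) obtain a where a: "a \<in> arcs T" "tail T a \<in> Poly_Mapping.keys f" "amap F a = \<gamma>" "head T a = n"
    by (rule keys_act_rtm)
  from n a Cons.prems(1) have "(tail T a, a # q) \<in> paths T"
    by (auto simp: paths_def pre_digraph.awalk_def pre_digraph.cas.simps)
  with a n show ?case by (intro bexI[of _ "tail T a"] exI[of _ "a # q"]) auto
qed

theorem quiver_rep_rtm:
  fixes Q :: "('v, 'e) pre_digraph" and T :: "('n, 'a) pre_digraph"
  assumes "bound_quiver TYPE('k::field) Q \<rho>" "rooted_tree T" "bound_morphism TYPE('k) T Q \<rho> F"
  shows "quiver_rep Q \<rho> (rtm T F :: ('k, _, _, _) rep)" "findim_rep Q (rtm T F :: ('k, _, _, _) rep)"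
proof -
  let ?M = "rtm T F :: ('k, _, _, _) rep"
  interpret vector_space "pm_scale :: 'k \<Rightarrow> ('n \<Rightarrow>\<^sub>0 'k) \<Rightarrow> _" by (rule vector_space_pm_scale)
  have fin: "fin_digraph T" using assms(2) by (simp add: rooted_tree_def tree_quiver_def)
  interpret T: fin_digraph T by (rule fin)
  have F: "quiver_morphism T Q F" using assms(3) by (simp add: bound_morphism_def)
  have sc: "scale ?M = pm_scale" by (simp add: rtm_def)
  have sp: "space ?M x = span {Poly_Mapping.single n 1 |n. n \<in> {n \<in> verts T. vmap F n = x}}" for x
    by (simp add: rtm_def)
  have keys: "Poly_Mapping.keys f \<subseteq> {n \<in> verts T. vmap F n = x}" if "f \<in> space ?M x" for f x
    using that unfolding sp by (rule keys_span)
  have act: "act ?M \<gamma> f = (\<Sum>n\<in>verts T. pm_scale (Poly_Mapping.lookup f n)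
     (\<Sum>a\<in>{a \<in> arcs T. tail T a = n \<and> amap F a = \<gamma>}. Poly_Mapping.single (head T a) 1))"
    if "f \<in> space ?M x" for f x \<gamma>
    using keys[OF that] by (intro act_rtm_superset) auto
  have subsp: "subspace (space ?M x)" for x unfolding sp by (rule subspace_span)
  have add: "act ?M \<gamma> (f + g) = act ?M \<gamma> f + act ?M \<gamma> g"
    if "f \<in> space ?M x" "g \<in> space ?M x" for f g x \<gamma>
    using that subspace_add[OF subsp that]
    by (simp add: act lookup_add scale_left_distrib sum.distrib)
  have scl: "act ?M \<gamma> (pm_scale c f) = pm_scale c (act ?M \<gamma> f)"
    if "f \<in> space ?M x" for f c x \<gamma>
    unfolding act[OF that] act[OF subspace_scale[OF subsp that]] scale_sum_right[of c]
    by (intro sum.cong refl) simp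
  have closed: "act ?M \<gamma> f \<in> space ?M (head Q \<gamma>)" if "f \<in> space ?M (tail Q \<gamma>)" for f \<gamma>
    unfolding act[OF that]
  proof (intro subspace_sum[OF subsp] subspace_scale[OF subsp])
    fix n a assume "a \<in> {a \<in> arcs T. tail T a = n \<and> amap F a = \<gamma>}"
    then show "Poly_Mapping.single (head T a) (1::'k) \<in> space ?M (head Q \<gamma>)"
      unfolding sp using F by (intro span_base) (auto simp: quiver_morphism_def)
  qed
  have rel: "fold (act ?M) p f = 0" if xp: "(x, p) \<in> \<rho>" and f: "f \<in> space ?M x" for x p f
  proof (rule ccontr)
    assume "fold (act ?M) p f \<noteq> 0"
    then obtain n q where nq: "n \<in> Poly_Mapping.keys f" "(n, q) \<in> paths T" "map (amap F) q = p"
      using fold_act_rtm_nonzero[OF T.wf_digraph, of f F p] keys[OF f] by auto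
    have "map_path F (n, q) = (x, p)" using nq keys[OF f] by (auto simp: map_path_def)
    moreover have "\<not> path_in_ideal TYPE('k) Q \<rho> (map_path F (n, q))"
      using nq(2) assms(3) unfolding bound_morphism_def by blast
    moreover have "path_in_ideal TYPE('k) Q \<rho> (x, p)"
      using xp by (auto simp: path_in_ideal_def ideal_of_def)
    ultimately show False by simp
  qed
  show "quiver_rep Q \<rho> ?M"
    unfolding quiver_rep_def sc
  proof (intro conjI ballI allI)
    fix xp assume "xp \<in> \<rho>"
    then show "case xp of (x, p) \<Rightarrow> \<forall>m\<in>space ?M x. fold (act ?M) p m = 0"
      by (auto intro: rel)
  qed (fact vector_space_pm_scale | rule subsp closed add scl; assumption?)+
  have "space ?M x = {0}" if "x \<notin> vmap F ` verts T" for x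
  proof -
    have "{n \<in> verts T. vmap F n = x} = {}" using that by auto
    then have "{Poly_Mapping.single n (1::'k) |n. n \<in> {n \<in> verts T. vmap F n = x}} = {}" by blast
    then show ?thesis unfolding sp by (simp only: span_empty)
  qed
  then have "{x \<in> verts Q. space ?M x \<noteq> {0}} \<subseteq> vmap F ` verts T" by blast
  then have "finite {x \<in> verts Q. space ?M x \<noteq> {0}}" by (rule finite_subset) simp
  moreover have "finite {Poly_Mapping.single n (1::'k) |n. n \<in> {n \<in> verts T. vmap F n = x}}" for x
    by simp
  ultimately show "findim_rep Q ?M" unfolding findim_rep_def sc
    by (intro conjI ballI exI) (assumption | rule sp)+
qed


section \<open>Pullback network and 2-covering network\<close>

definition pullback_network ::
  "('n1, 'a1) pre_digraph \<Rightarrow> ('n1, 'a1, 'v, 'e) quiver_map \<Rightarrow>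
   ('n2, 'a2) pre_digraph \<Rightarrow> ('n2, 'a2, 'v, 'e) quiver_map \<Rightarrow>
   ('n1 \<times> 'n2, 'a1 \<times> 'a2) network" where
  "pullback_network T1 F1 T2 F2 = \<lparr>
     quiver = \<lparr>
       verts = {(n, m). n \<in> verts T1 \<and> m \<in> verts T2 \<and> vmap F1 n = vmap F2 m},
       arcs = {(a, b). a \<in> arcs T1 \<and> b \<in> arcs T2 \<and> amap F1 a = amap F2 b},
       tail = map_prod (tail T1) (tail T2),
       head = map_prod (head T1) (head T2)\<rparr>,
     edges = {{(n, m), (n, m')} |n m m'.
       n \<in> verts T1 \<and> m \<in> verts T2 - {tree_root T2} \<and> m' \<in> verts T2 - {tree_root T2} \<and>
       vmap F1 n = vmap F2 m \<and> vmap F1 n = vmap F2 m' \<and>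
       m \<noteq> m' \<and> parent T2 m = parent T2 m' \<and>
       amap F2 (out_arc T2 m) = amap F2 (out_arc T2 m')}\<rparr>"

text \<open>
  The triple \<open>(n, m, i)\<close> is encoded as \<open>((n, m), i)\<close>, so that the projection \<open>\<pi>\<close> is \<^const>\<open>fst\<close>.
\<close>

definition covering_network ::
  "('w1 \<times> 'w2, 'b) network \<Rightarrow> (('w1 \<times> 'w2) \<times> int, 'b \<times> int) network" where
  "covering_network N = \<lparr>
     quiver = \<lparr>
       verts = verts (quiver N) \<times> {-1, 1},
       arcs = arcs (quiver N) \<times> {-1, 1},
       tail = map_prod (tail (quiver N)) id,
       head = map_prod (head (quiver N)) id\<rparr>,
     edges = {{((n, m), i), ((n, m'), -i)} |n m m' i.
       {(n, m), (n, m')} \<in> edges N \<and> i \<in> {-1, 1}}\<rparr>"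

fun link_proj :: "('w \<times> int, 'b \<times> int) link \<Rightarrow> ('w, 'b) link" where
  "link_proj (Arr b) = Arr (fst b)"
| "link_proj (Inv b) = Inv (fst b)"
| "link_proj (Edge e) = Edge (fst ` e)"

definition walk_proj ::
  "('w \<times> int) list \<times> ('w \<times> int, 'b \<times> int) link list \<Rightarrow> 'w list \<times> ('w, 'b) link list" where
  "walk_proj t = (map fst (fst t), map link_proj (snd t))"

definition R1 :: "('w, 'b) network \<Rightarrow> ('w list \<times> ('w, 'b) link list) set" where
  "R1 N = {t. traversal N t \<and> length (snd t) = 2 \<and> triangle N (set (fst t))}"

definition R2 ::
  "('w1 \<times> 'w2, 'b) network \<Rightarrow>
   ((('w1 \<times> 'w2) \<times> int) list \<times> (('w1 \<times> 'w2) \<times> int, 'b \<times> int) link list) set" where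
  "R2 N = {t. traversal (covering_network N) t \<and> walk_proj t \<in> R1 N}"


section \<open>Generalized graph maps\<close>

definition R2_free ::
  "('w1 \<times> 'w2, 'b) network \<Rightarrow> (('w1 \<times> 'w2) \<times> int, 'b \<times> int) network \<Rightarrow> bool" where
  "R2_free N M \<longleftrightarrow> (\<forall>t. traversal M t \<longrightarrow> t \<notin> R2 N)"

definition involution_free :: "('w \<times> int, 'b) network \<Rightarrow> bool" where
  "involution_free M \<longleftrightarrow> (\<forall>x j. (x, j) \<in> verts (quiver M) \<longrightarrow> (x, -j) \<notin> verts (quiver M))"

definition complete_network ::
  "('n1, 'a1) pre_digraph \<Rightarrow> ('n2, 'a2) pre_digraph \<Rightarrow> ('n2, 'a2, 'v, 'e) quiver_map \<Rightarrow>
   (('n1 \<times> 'n2) \<times> int, ('a1 \<times> 'a2) \<times> int) network \<Rightarrow> bool" where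
  "complete_network T1 T2 F2 M \<longleftrightarrow> (\<forall>n m j. ((n, m), j) \<in> verts (quiver M) \<longrightarrow>
     (\<forall>a\<in>arcs T1. head T1 a = n \<longrightarrow>
        (\<exists>b\<in>arcs T2. head T2 b = m \<and> ((a, b), j) \<in> arcs (quiver M))) \<and>
     (\<forall>b\<in>arcs T2. tail T2 b = m \<longrightarrow>
        (\<exists>a\<in>arcs T1. tail T1 a = n \<and> ((a, b), j) \<in> arcs (quiver M)) \<or>
        (\<exists>b''\<in>arcs T2. head T2 b'' = head T2 b \<and> amap F2 b = amap F2 b'' \<and>
           ((n, tail T2 b''), -j) \<in> verts (quiver M) \<and>
           {((n, m), j), ((n, tail T2 b''), -j)} \<in> edges M)))"

definition generalized_graph_map ::
  "('n1, 'a1) pre_digraph \<Rightarrow> ('n1, 'a1, 'v, 'e) quiver_map \<Rightarrow>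
   ('n2, 'a2) pre_digraph \<Rightarrow> ('n2, 'a2, 'v, 'e) quiver_map \<Rightarrow>
   (('n1 \<times> 'n2) \<times> int, ('a1 \<times> 'a2) \<times> int) network \<Rightarrow> bool" where
  "generalized_graph_map T1 F1 T2 F2 M \<longleftrightarrow>
     subnetwork M (covering_network (pullback_network T1 F1 T2 F2)) \<and>
     verts (quiver M) \<noteq> {} \<and>
     complete_network T1 T2 F2 M \<and>
     network_connected M \<and>
     R2_free (pullback_network T1 F1 T2 F2) M \<and>
     involution_free M"

end

theory Submission
  imports Defs
begin

text \<open>
  Call siblings \<open>n \<noteq> m\<close> with equally labelled arrows a fold if the subtree above \<open>n\<close> maps over \<open>Q\<close> to
  the subtree above \<open>m\<close>; each of the three conditions is equivalent to the absence of folds. A fold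
  extends by the identity to an idempotent of \<open>T\<close>, and a vertex of minimal depth that an idempotent
  moves gives a fold. The graph of an idempotent is a generalized graph map, and completeness of a
  generalized graph map through \<open>(n, m)\<close> yields a map between the subtrees above \<open>n\<close> and \<open>m\<close>. An
  idempotent of \<open>T\<close> induces an idempotent endomorphism of the module. Conversely, nonzero entries
  of the matrix of an idempotent endomorphism give maps between subtrees, so that without folds the
  matrix is scalar plus nilpotent and hence \<open>0\<close> or \<open>1\<close>.
\<close>

section \<open>Walks\<close>

lemma walk_single [simp]: "walk N ([x], []) \<longleftrightarrow> x \<in> verts (quiver N)"
  by (simp add: walk_def)

lemma walk_Cons:
  "walk N (x # y # xs, l # ls) \<longleftrightarrow>
     x \<in> verts (quiver N) \<and> step N x l y \<and> walk N (y # xs, ls)"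
  by (auto simp: walk_def All_less_Suc2)

lemma traversal_Cons:
  "traversal N (x # y # xs, l # ls) \<longleftrightarrow>
     x \<in> verts (quiver N) \<and> step N x l y \<and> traversal N (y # xs, ls) \<and>
     (ls \<noteq> [] \<longrightarrow> hd ls \<noteq> link_inv l)"
proof -
  have "(\<forall>i. Suc i < length (l # ls) \<longrightarrow> (l # ls) ! Suc i \<noteq> link_inv ((l # ls) ! i)) \<longleftrightarrow>
    (ls \<noteq> [] \<longrightarrow> hd ls \<noteq> link_inv l) \<and>
    (\<forall>i. Suc i < length ls \<longrightarrow> ls ! Suc i \<noteq> link_inv (ls ! i))" (is "?L \<longleftrightarrow> ?R")
  proof
    assume L: ?L
    show ?R
    proof (intro conjI impI allI)
      assume "ls \<noteq> []" then show "hd ls \<noteq> link_inv l" using L[rule_format, of 0]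
        by (simp add: hd_conv_nth)
    next
      fix i assume "Suc i < length ls"
      then show "ls ! Suc i \<noteq> link_inv (ls ! i)" using L[rule_format, of "Suc i"] by simp
    qed
  next
    assume R: ?R
    show ?L
    proof (intro allI impI)
      fix i assume "Suc i < length (l # ls)"
      then show "(l # ls) ! Suc i \<noteq> link_inv ((l # ls) ! i)"
        using R by (cases i) (auto simp: hd_conv_nth)
    qed
  qed
  then show ?thesis unfolding traversal_def by (auto simp: walk_Cons)
qed

text \<open>This makes cancellation possible: deleting a link and its inverse leaves a walk, since
  both lead between the same two vertices. For an edge, one end determines the other.\<close>

lemma step_link_inv_unique:
  "step N x l y \<Longrightarrow> step N y (link_inv l) z \<Longrightarrow> z = x"
  by (cases l) (auto simp: doubleton_eq_iff)

text \<open>A walk becomes a traversal by cancelling each link against its inverse as it is prepended.\<close>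

lemma reachable_imp_traversal:
  assumes "wf_network N" "v \<in> verts (quiver N)" "(\<lambda>x y. \<exists>l. step N x l y)\<^sup>*\<^sup>* u v"
  shows "\<exists>t. traversal N t \<and> hd (fst t) = u \<and> last (fst t) = v"
  using assms(3)
proof (induction rule: converse_rtranclp_induct)
  case base
  have "traversal N ([v], [])" using assms(2) by (simp add: traversal_def)
  then show ?case by force
next
  case (step x y)
  then obtain l xs ls where l: "step N x l y"
    and t: "traversal N (xs, ls)" "hd xs = y" "last xs = v" by auto
  have "length xs = Suc (length ls)" using t(1) by (simp add: traversal_def walk_def)
  then obtain ys where xs: "xs = y # ys" using t(2) by (cases xs) auto
  have x: "x \<in> verts (quiver N)"
    using l assms(1) by (cases l) (auto simp: wf_network_def wf_digraph_def)
  show ?case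
  proof (cases "ls \<noteq> [] \<and> hd ls = link_inv l")
    case True
    then obtain ls' where ls: "ls = link_inv l # ls'" by (cases ls) auto
    then obtain z zs where "ys = z # zs" using xs \<open>length xs = _\<close> by (cases ys) auto
    then have "traversal N (z # zs, ls')" "step N y (link_inv l) z" "last (z # zs) = v"
      using t xs ls by (auto simp: traversal_Cons)
    with step_link_inv_unique[OF l] show ?thesis by (intro exI[of _ "(z # zs, ls')"]) auto
  next
    case False
    then have "traversal N (x # y # ys, l # ls)" using t(1) xs l x by (auto simp: traversal_Cons)
    then show ?thesis using t(3) xs by (intro exI[of _ "(x # y # ys, l # ls)"]) auto
  qed
qed


section \<open>Rooted trees\<close>

context wf_digraph
begin

text \<open>The list \<open>awalk_verts u p\<close> already ends in \<open>w\<close>, so the second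
  walk contributes only \<open>xs\<close>.\<close>

lemma walk_awalk_append:
  assumes "awalk u p w" "walk \<lparr>quiver = G, edges = {}\<rparr> (w # xs, ls)"
  shows "walk \<lparr>quiver = G, edges = {}\<rparr> (awalk_verts u p @ xs, map Arr p @ ls)"
  using assms(1)
proof (induction p arbitrary: u)
  case Nil
  then show ?case using assms(2) by (auto simp: awalk_Nil_iff)
next
  case (Cons e p)
  then have *: "walk \<lparr>quiver = G, edges = {}\<rparr> (awalk_verts (head G e) p @ xs, map Arr p @ ls)"
    and e: "e \<in> arcs G" "tail G e = u" and p: "awalk (head G e) p w"
    by (auto simp: awalk_Cons_iff)
  from p obtain ys where "awalk_verts (head G e) p = head G e # ys"
    by (cases p) (auto simp: awalk_Cons_iff)
  with * e show ?case by (auto simp: walk_Cons)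
qed

lemma walk_awalk_reverse:
  assumes "awalk u q w"
  shows "walk \<lparr>quiver = G, edges = {}\<rparr> (w # rev (map (tail G) q), map Inv (rev q))"
  using assms
proof (induction q arbitrary: w rule: rev_induct)
  case Nil
  then show ?case by (auto simp: awalk_Nil_iff)
next
  case (snoc e q)
  then have "awalk u q (tail G e)" "e \<in> arcs G" "head G e = w"
    by (auto simp: awalk_Cons_iff awalk_Nil_iff)
  then show ?case using snoc.IH[of "tail G e"] by (auto simp: walk_Cons)
qed

lemma awalk_verts_heads:
  assumes "awalk u p v"
  shows "awalk_verts u p = u # map (head G) p"
  using assms by (induction p arbitrary: u) (auto simp: awalk_simps)

text \<open>Follow \<open>p\<close> from \<open>u\<close> to \<open>w\<close> and return against
  \<open>q\<close>. The heads of \<open>p\<close> and the tails of \<open>q\<close> are the vertices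
  visited after the start, so their distinctness is what \<open>undirected_cycle\<close> asks of the
  tail of the vertex list. Empty \<open>q\<close> with \<open>u = w\<close> covers directed
  cycles.\<close>

lemma undirected_cycleI:
  assumes p: "awalk u p w" "p \<noteq> []" and q: "awalk u q w" and hd: "q \<noteq> [] \<or> u = w"
    and dist: "distinct (map (head G) p @ map (tail G) q)" "distinct (p @ q)"
  shows "\<exists>c. undirected_cycle G c"
proof -
  let ?c = "(awalk_verts u p @ rev (map (tail G) q), map Arr p @ map Inv (rev q))"
  have vs: "awalk_verts u p = u # map (head G) p"
    by (rule awalk_verts_heads[OF p(1)])
  have "last (u # map (head G) p) = w"
    using p vs by (metis awalk_def awlast_if_cas)
  then have "last (fst ?c) = u" using q hd
    by (cases q) (auto simp: vs last_rev awalk_Cons_iff)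
  moreover have "distinct (map link_arc (snd ?c))" using dist(2) by (simp add: comp_def)
  moreover have "walk \<lparr>quiver = G, edges = {}\<rparr> ?c"
    by (rule walk_awalk_append[OF p(1) walk_awalk_reverse[OF q]])
  ultimately have "undirected_cycle G ?c"
    using p(2) dist by (auto simp: undirected_cycle_def vs)
  then show ?thesis by blast
qed

end

text \<open>A non-empty closed walk contains a directed cycle, which is an undirected cycle with
  empty way back.\<close>

lemma (in wf_digraph) no_closed_awalk:
  assumes "\<nexists>c. undirected_cycle G c" "awalk u p u"
  shows "p = []"
proof (rule ccontr)
  assume "p \<noteq> []"
  then have "closed_w p" using assms(2) by (auto simp: closed_w_def)
  then obtain q v where q: "awalk v q v" "distinct (tl (awalk_verts v q))" "distinct q" "q \<noteq> []"
    using closed_w_imp_cycle cycle_conv by metis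
  then have "distinct (map (head G) q)" by (simp add: awalk_verts_heads[OF q(1)])
  with q assms(1) show False
    using undirected_cycleI[of v q v "[]"] by (auto simp: awalk_Nil_iff)
qed

text \<open>
  Two directed walks with different first arrows and the same end points contain an undirected cycle:
  when their total length is minimal, they are internally disjoint.
\<close>

lemma (in wf_digraph) no_parallel_awalks:
  assumes nc: "\<nexists>c. undirected_cycle G c"
  shows "awalk u (a # p) w \<Longrightarrow> awalk u (b # q) w \<Longrightarrow> a = b"
proof (induction "length p + length q" arbitrary: p q w rule: less_induct)
  case less
  show ?case
  proof (rule ccontr)
    assume ab: "a \<noteq> b"
    \<comment> \<open>If the head of \<open>c\<close> is the tail of \<open>d\<close>, cutting both
      walks there gives a closed walk (when nothing precedes \<open>d\<close>) or a shorter pair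
      with the same first arrows, against the induction hypothesis. The primed variables allow the
      two walks to be exchanged.\<close>
    have ne: "head G c \<noteq> tail G d"
      if P: "awalk u (a' # p') w" "awalk u (b' # q') w" "a' \<noteq> b'" "{a', b'} = {a, b}"
        "length p' + length q' = length p + length q" "c \<in> set (a' # p')" "d \<in> set (b' # q')"
      for a' b' c d p' q'
    proof
      assume cd: "head G c = tail G d"
      obtain p1 p2 where p1: "a' # p' = p1 @ c # p2" using P(6) by (meson split_list)
      obtain q1 q2 where q1: "b' # q' = q1 @ d # q2" using P(7) by (meson split_list)
      have wp: "awalk u (p1 @ [c]) (head G c)" using P(1) unfolding p1
        by (auto simp: awalk_Cons_iff awalk_Nil_iff)
      have wq: "awalk u q1 (tail G d)" using P(2) unfolding q1
        by (auto simp: awalk_Cons_iff awalk_Nil_iff)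
      show False
      proof (cases q1)
        case Nil
        then show False using wp wq cd no_closed_awalk[OF nc, of u "p1 @ [c]"]
          by (auto simp: awalk_Nil_iff)
      next
        case (Cons b'' q1')
        then have b'': "b'' = b'" using q1 by simp
        obtain p1' where p1': "p1 @ [c] = a' # p1'" using p1 by (cases p1) auto
        have "length p1' \<le> length p'" "length q1' < length q'"
          using arg_cong[OF p1, of length] arg_cong[OF p1', of length]
            arg_cong[OF q1, of length] Cons by auto
        then have less': "length p1' + length q1' < length p + length q" using P(5) by linarith
        have "awalk u (a' # p1') (head G c)" "awalk u (b' # q1') (head G c)"
          using wp wq p1' cd Cons b'' by auto
        with less' P(3,4) show False
          using less.hyps[of p1' q1' "head G c"] less.hyps[of q1' p1' "head G c"]
          by (auto simp: doubleton_eq_iff add.commute)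
      qed
    qed
    have dj: "head G c \<noteq> tail G d" if "c \<in> set (a # p)" "d \<in> set (b # q)" for c d
      using ne[OF less.prems ab _ _ that] by auto
    have dj': "head G c \<noteq> tail G d" if "c \<in> set (b # q)" "d \<in> set (a # p)" for c d
      using ne[OF less.prems(2,1) ab[symmetric] _ _ that] by auto
    have ap: "distinct (awalk_verts x r)" if "awalk x r y" for x r y
    proof (rule ccontr)
      assume "\<not> distinct (awalk_verts x r)"
      from awalk_not_distinct_decomp[OF that this] obtain s z where "awalk z s z" "s \<noteq> []" by auto
      with no_closed_awalk[OF nc] show False by blast
    qed
    have "distinct (map (head G) (a # p))" "distinct (a # p)"
      using ap[OF less.prems(1)] unfolding awalk_verts_heads[OF less.prems(1)] distinct_map
      by (auto simp: distinct_map)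
    moreover have "distinct (map (tail G) (b # q))" "distinct (b # q)"
      using ap[OF less.prems(2)] by (auto simp: awalk_verts_conv distinct_map)
    moreover have "set (a # p) \<inter> set (b # q) = {}"
    proof (rule ccontr)
      assume "set (a # p) \<inter> set (b # q) \<noteq> {}"
      then obtain c where c: "c \<in> set (a # p)" "c \<in> set (b # q)" by blast
      \<comment> \<open>A common arrow comes first on both walks: the head of an arrow just before
        it would be the tail of \<open>c\<close>, which \<open>dj\<close> and \<open>dj'\<close>
        exclude.\<close>
      have hd: "c = e" if cr: "c \<in> set (e # r)" and wr: "awalk x (e # r) y"
        and nt: "\<And>d. d \<in> set (e # r) \<Longrightarrow> head G d \<noteq> tail G c" for e r x y
      proof -
        obtain r1 r2 where r: "e # r = r1 @ c # r2" using split_list[OF cr] by blast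
        show ?thesis
        proof (cases r1 rule: rev_cases)
          case Nil then show ?thesis using r by simp
        next
          case (snoc r0 d)
          then have "awalk x (r0 @ d # c # r2) y" using wr r by simp
          then have "head G d = tail G c" by (auto simp: awalk_Cons_iff)
          then show ?thesis using nt[of d] r snoc by simp
        qed
      qed
      have "c = a" using hd[OF c(1) less.prems(1)] dj c by blast
      moreover have "c = b" using hd[OF c(2) less.prems(2)] dj' c by blast
      ultimately show False using ab by simp
    qed
    ultimately show False
      using undirected_cycleI[OF less.prems(1) _ less.prems(2)] dj nc
      by (simp add: disjoint_iff image_iff) metis
  qed
qed

section \<open>Root, parents and depth\<close>

locale root_tree = fin_digraph T for T :: "('n, 'a) pre_digraph" +
  assumes rooted: "rooted_tree T"
begin

abbreviation root :: 'n where "root \<equiv> tree_root T"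
abbreviation par :: "'n \<Rightarrow> 'n" where "par \<equiv> parent T"

lemma no_cycle: "\<nexists>c. undirected_cycle T c"
  using rooted by (auto simp: rooted_tree_def tree_quiver_def simp del: not_ex)

lemma sink_root: "sink T root"
  using rooted unfolding rooted_tree_def tree_root_def by (blast intro: theI')

lemma root_in_verts [simp]: "root \<in> verts T"
  using sink_root by (simp add: sink_def)

lemma tail_neq_root: "a \<in> arcs T \<Longrightarrow> tail T a \<noteq> root"
  using sink_root by (auto simp: sink_def)

text \<open>A vertex without outgoing arrow would be a second sink.\<close>

lemma ex_out_arc:
  assumes "n \<in> verts T" "n \<noteq> root"
  shows "\<exists>a\<in>arcs T. tail T a = n"
proof (rule ccontr)
  assume "\<not> ?thesis"
  then have "sink T n" using assms(1) by (auto simp: sink_def out_arcs_def)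
  then show False using assms(2) sink_root rooted by (auto simp: rooted_tree_def)
qed

text \<open>The arrows form a finite acyclic relation, so its converse is well-founded: following
  outgoing arrows ends, necessarily at the only sink.\<close>

lemma awalk_to_root:
  assumes "n \<in> verts T"
  shows "\<exists>p. awalk n p root"
proof -
  define A where "A = (\<lambda>a. (tail T a, head T a)) ` arcs T"
  have walk: "\<exists>p. p \<noteq> [] \<and> awalk u p v" if "(u, v) \<in> A\<^sup>+" for u v
    using that
  proof (induction rule: trancl_induct)
    case (base v)
    then obtain a where "a \<in> arcs T" "tail T a = u" "head T a = v" by (auto simp: A_def)
    then show ?case by (intro exI[of _ "[a]"]) (auto simp: awalk_simps)
  next
    case (step v w)
    then obtain p a where "awalk u p v" "a \<in> arcs T" "tail T a = v" "head T a = w"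
      by (auto simp: A_def)
    then have "awalk u (p @ [a]) w" by (auto simp: awalk_simps)
    then show ?case by (intro exI[of _ "p @ [a]"]) auto
  qed
  have "acyclic A"
    using walk no_closed_awalk[OF no_cycle] by (metis acyclicI)
  then have "wf (A\<inverse>)" by (intro finite_acyclic_wf_converse) (simp_all add: A_def)
  then show ?thesis using assms
  proof (induction n rule: wf_induct_rule)
    case (less n)
    show ?case
    proof (cases "n = root")
      case True
      then show ?thesis by (intro exI[of _ "[]"]) (simp add: awalk_simps)
    next
      case False
      then obtain a where a: "a \<in> arcs T" "tail T a = n" using ex_out_arc less.prems by blast
      then have "(head T a, n) \<in> A\<inverse>" by (auto simp: A_def)
      moreover have "head T a \<in> verts T" using a by simp
      ultimately obtain p where "awalk (head T a) p root" using less.IH by blast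
      then have "awalk n (a # p) root" using a by (auto simp: awalk_simps)
      then show ?thesis by blast
    qed
  qed
qed

text \<open>Continued to the root, two different arrows with the same tail would begin parallel
  walks.\<close>

lemma out_arc_unique:
  assumes "a \<in> arcs T" "b \<in> arcs T" "tail T a = tail T b"
  shows "a = b"
proof -
  obtain p q where "awalk (head T a) p root" "awalk (head T b) q root"
    using awalk_to_root assms by (meson head_in_verts)
  then have "awalk (tail T a) (a # p) root" "awalk (tail T a) (b # q) root"
    using assms by (auto simp: awalk_simps)
  then show ?thesis by (rule no_parallel_awalks[OF no_cycle])
qed

lemma out_arc_tail [simp]: "a \<in> arcs T \<Longrightarrow> out_arc T (tail T a) = a"
  unfolding out_arc_def by (rule the_equality) (auto intro: out_arc_unique)

lemma out_arc_props:
  assumes "n \<in> verts T" "n \<noteq> root"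
  shows "out_arc T n \<in> arcs T" "tail T (out_arc T n) = n"
  using ex_out_arc[OF assms] by auto

lemma parent_in_verts: "n \<in> verts T \<Longrightarrow> n \<noteq> root \<Longrightarrow> par n \<in> verts T"
  by (simp add: parent_def out_arc_props)

lemma parent_tail [simp]: "a \<in> arcs T \<Longrightarrow> par (tail T a) = head T a"
  by (simp add: parent_def)

lemma awalk_to_root_unique: "awalk n p root \<Longrightarrow> awalk n q root \<Longrightarrow> p = q"
proof (induction p arbitrary: n q)
  case Nil
  then show ?case using tail_neq_root by (cases q) (auto simp: awalk_simps)
next
  case (Cons a p)
  then obtain b q' where q: "q = b # q'" using tail_neq_root by (cases q) (auto simp: awalk_simps)
  then have "a = b" using Cons.prems by (auto simp: awalk_simps intro: out_arc_unique)
  then show ?case using Cons q by (auto simp: awalk_simps)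
qed

definition depth :: "'n \<Rightarrow> nat" where
  "depth n = length (THE p. awalk n p root)"

lemma depth_eq: "awalk n p root \<Longrightarrow> depth n = length p"
  unfolding depth_def by (subst the_equality[of _ p]) (auto intro: awalk_to_root_unique)

lemma depth_root [simp]: "depth root = 0"
  using depth_eq[of root "[]"] by (simp add: awalk_simps)

lemma depth_tail: "a \<in> arcs T \<Longrightarrow> depth (tail T a) = Suc (depth (head T a))"
proof -
  assume a: "a \<in> arcs T"
  then obtain p where p: "awalk (head T a) p root" using awalk_to_root head_in_verts by blast
  then have "awalk (tail T a) (a # p) root" using a by (simp add: awalk_simps)
  then show ?thesis using depth_eq p by fastforce
qed

lemma depth_parent: "n \<in> verts T \<Longrightarrow> n \<noteq> root \<Longrightarrow> depth n = Suc (depth (par n))"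
  using depth_tail[of "out_arc T n"] by (simp add: out_arc_props parent_def)

lemma depth_0_iff [simp]: "n \<in> verts T \<Longrightarrow> depth n = 0 \<longleftrightarrow> n = root"
  using depth_parent by fastforce

lemma vertex_induct [consumes 1, case_names root step]:
  assumes "n \<in> verts T" "P root"
    and "\<And>n. n \<in> verts T \<Longrightarrow> n \<noteq> root \<Longrightarrow> P (par n) \<Longrightarrow> P n"
  shows "P n"
  using assms(1)
proof (induction "depth n" arbitrary: n)
  case 0
  then show ?case using assms(2) by simp
next
  case (Suc k)
  then have "n \<noteq> root" by auto
  then show ?case using Suc assms(3) depth_parent[of n] parent_in_verts[of n] by simp
qed

end


section \<open>Trees over a quiver\<close>

locale tree_over = root_tree T for T :: "('n, 'a) pre_digraph" +
  fixes Q :: "('v, 'e) pre_digraph" and F :: "('n, 'a, 'v, 'e) quiver_map"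
  assumes morphism: "quiver_morphism T Q F"
begin

abbreviation label :: "'n \<Rightarrow> 'e" where "label n \<equiv> amap F (out_arc T n)"

lemma vmap_in_verts: "n \<in> verts T \<Longrightarrow> vmap F n \<in> verts Q"
  using morphism by (simp add: quiver_morphism_def)

lemma label_props:
  assumes "n \<in> verts T" "n \<noteq> root"
  shows "label n \<in> arcs Q" "tail Q (label n) = vmap F n" "head Q (label n) = vmap F (par n)"
  using morphism out_arc_props[OF assms] by (auto simp: quiver_morphism_def parent_def)

text \<open>The sibling condition of (3); a fold is such a pair with \<open>sim n m\<close>. The
  root is excluded because \<open>par\<close> and \<open>label\<close> carry no meaning
  there.\<close>

definition fold_pair :: "'n \<Rightarrow> 'n \<Rightarrow> bool" where
  "fold_pair n m \<longleftrightarrow> n \<in> verts T \<and> m \<in> verts T \<and> n \<noteq> root \<and> m \<noteq> root \<and> n \<noteq> m \<and>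
     par n = par m \<and> label n = label m"

text \<open>
  \<open>sim n m\<close>: the subtree of \<open>T\<close> above \<open>n\<close> maps to the subtree above \<open>m\<close> over \<open>Q\<close>, sending
  \<open>n\<close> to \<open>m\<close>.
\<close>

coinductive sim :: "'n \<Rightarrow> 'n \<Rightarrow> bool" where
  simI: "(\<And>x. x \<in> verts T \<Longrightarrow> x \<noteq> root \<Longrightarrow> par x = n \<Longrightarrow>
           \<exists>y. y \<in> verts T \<and> y \<noteq> root \<and> par y = m \<and> label y = label x \<and> sim x y)
         \<Longrightarrow> sim n m"

lemma simE:
  assumes "sim n m" "x \<in> verts T" "x \<noteq> root" "par x = n"
  obtains y where "y \<in> verts T" "y \<noteq> root" "par y = m" "label y = label x" "sim x y"
  using assms by (meson sim.cases)

text \<open>Coinduction in which children are again related by \<open>R\<close> itself, the form in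
  which it applies to the support of a matrix in \<open>coef_sim\<close>.\<close>

lemma sim_coinductI:
  assumes "R n m"
    and "\<And>n m x. R n m \<Longrightarrow> x \<in> verts T \<Longrightarrow> x \<noteq> root \<Longrightarrow> par x = n \<Longrightarrow>
      \<exists>y. y \<in> verts T \<and> y \<noteq> root \<and> par y = m \<and> label y = label x \<and> R x y"
  shows "sim n m"
  using assms(1)
proof (rule sim.coinduct[of R])
  fix n m assume R: "R n m"
  show "\<exists>n' m'. n = n' \<and> m = m' \<and> (\<forall>x. x \<in> verts T \<longrightarrow> x \<noteq> root \<longrightarrow> par x = n' \<longrightarrow>
    (\<exists>y. y \<in> verts T \<and> y \<noteq> root \<and> par y = m' \<and> label y = label x \<and> (R x y \<or> sim x y)))"
  proof (rule exI[of _ n], rule exI[of _ m], intro conjI refl allI impI)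
    fix x assume "x \<in> verts T" "x \<noteq> root" "par x = n"
    from assms(2)[OF R this]
    obtain y where "y \<in> verts T \<and> y \<noteq> root \<and> par y = m \<and> label y = label x \<and> R x y" by (rule exE)
    then show "\<exists>y. y \<in> verts T \<and> y \<noteq> root \<and> par y = m \<and> label y = label x \<and> (R x y \<or> sim x y)"
      by (intro exI[of _ y]) simp
  qed
qed

lemma sim_refl: "sim n n"
  by (coinduction arbitrary: n) auto

lemma sim_trans: "sim n m \<Longrightarrow> sim m k \<Longrightarrow> sim n k"
proof (coinduction arbitrary: n m k)
  case sim
  have "\<exists>y. y \<in> verts T \<and> y \<noteq> root \<and> par y = k \<and> label y = label x \<and> (\<exists>z. sim x z \<and> sim z y)"
    if x: "x \<in> verts T" "x \<noteq> root" "par x = n" for x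
  proof -
    obtain z where z: "z \<in> verts T" "z \<noteq> root" "par z = m" "label z = label x" "sim x z"
      using simE[OF sim(1) x] by metis
    obtain y where "y \<in> verts T" "y \<noteq> root" "par y = k" "label y = label z" "sim z y"
      using simE[OF sim(2) z(1-3)] by metis
    with z show ?thesis by auto
  qed
  then show ?case by blast
qed

text \<open>A map starting at the root is defined on all of \<open>T\<close> and raises every depth
  by \<open>depth m\<close>; at a vertex of maximal depth this forces
  \<open>depth m = 0\<close>.\<close>

lemma sim_root:
  assumes "sim root m" "m \<in> verts T"
  shows "m = root"
proof -
  have *: "\<exists>y\<in>verts T. sim x y \<and> depth y = depth x + depth m" if "x \<in> verts T" for x
    using that
  proof (induction rule: vertex_induct)
    case root
    then show ?case using assms by auto
  next
    case (step n)
    then obtain y where y: "y \<in> verts T" "sim (par n) y" "depth y = depth (par n) + depth m" by auto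
    obtain z where z: "z \<in> verts T" "z \<noteq> root" "par z = y" "sim n z"
      using simE[OF y(2) step(1,2)] by metis
    then show ?case using y(3) depth_parent[OF step(1,2)] depth_parent[OF z(1,2)] by auto
  qed
  have fin: "finite (depth ` verts T)" "depth ` verts T \<noteq> {}" using root_in_verts by (simp, blast)
  from Max_in[OF this] obtain x where "x \<in> verts T" "depth x = Max (depth ` verts T)" by auto
  then have x: "x \<in> verts T" "\<And>y. y \<in> verts T \<Longrightarrow> depth y \<le> depth x"
    using Max_ge[OF fin(1)] by auto
  from *[OF x(1)] x(2) have "depth m = 0" by force
  then show ?thesis using assms(2) by simp
qed

text \<open>The idempotents excluded by (2), so the identity of \<open>T\<close> does not count as
  one.\<close>

definition retraction :: "('n, 'a, 'n, 'a) quiver_map \<Rightarrow> bool" where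
  "retraction \<iota> \<longleftrightarrow> quiver_morphism T T \<iota> \<and> qeq T (qcomp \<iota> \<iota>) \<iota> \<and> \<not> qeq T \<iota> qid \<and> qeq T (qcomp F \<iota>) F"

section \<open>Folds from idempotents of the tree\<close>

context
  fixes \<iota> assumes retr: "retraction \<iota>"
begin

lemma retr_in_verts: "n \<in> verts T \<Longrightarrow> vmap \<iota> n \<in> verts T"
  and retr_idem: "n \<in> verts T \<Longrightarrow> vmap \<iota> (vmap \<iota> n) = vmap \<iota> n"
  and retr_vmap: "n \<in> verts T \<Longrightarrow> vmap F (vmap \<iota> n) = vmap F n"
  and retr_arc: "a \<in> arcs T \<Longrightarrow> amap \<iota> a \<in> arcs T" "a \<in> arcs T \<Longrightarrow> amap F (amap \<iota> a) = amap F a"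
    "a \<in> arcs T \<Longrightarrow> tail T (amap \<iota> a) = vmap \<iota> (tail T a)"
    "a \<in> arcs T \<Longrightarrow> head T (amap \<iota> a) = vmap \<iota> (head T a)"
  using retr by (auto simp: retraction_def quiver_morphism_def qeq_def qcomp_def)

text \<open>The image of the arrow leaving \<open>n\<close> leaves \<open>vmap \<iota> n\<close>,
  and is therefore the only arrow doing so.\<close>

lemma retr_nonroot:
  assumes "n \<in> verts T" "n \<noteq> root"
  shows "vmap \<iota> n \<noteq> root" "par (vmap \<iota> n) = vmap \<iota> (par n)" "label (vmap \<iota> n) = label n"
proof -
  let ?a = "out_arc T n"
  have a: "?a \<in> arcs T" "tail T ?a = n" using out_arc_props[OF assms] .
  have b: "amap \<iota> ?a \<in> arcs T" "tail T (amap \<iota> ?a) = vmap \<iota> n" using retr_arc[OF a(1)] a by auto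
  show "vmap \<iota> n \<noteq> root" using tail_neq_root[OF b(1)] b(2) by simp
  have "out_arc T (vmap \<iota> n) = amap \<iota> ?a" using out_arc_tail[OF b(1)] b(2) by simp
  then show "par (vmap \<iota> n) = vmap \<iota> (par n)" "label (vmap \<iota> n) = label n"
    using retr_arc[OF a(1)] by (simp_all add: parent_def)
qed

text \<open>Every depth grows by the depth \<open>d\<close> of the image of the root. At that image,
  which is fixed by idempotence, this reads \<open>d = d + d\<close>.\<close>

lemma retr_root: "vmap \<iota> root = root"
proof -
  have *: "depth (vmap \<iota> n) = depth n + depth (vmap \<iota> root)" if "n \<in> verts T" for n
    using that
  proof (induction rule: vertex_induct)
    case (step n)
    then show ?case
      using depth_parent[of n] depth_parent[of "vmap \<iota> n"] retr_in_verts retr_nonroot by auto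
  qed simp
  from *[of "vmap \<iota> root"] have "depth (vmap \<iota> root) = 0" by (simp add: retr_in_verts retr_idem)
  then show ?thesis by (simp add: retr_in_verts)
qed

text \<open>Arrows are determined by their tails, so a morphism fixing all vertices fixes all
  arrows.\<close>

lemma retr_moves: "\<exists>n\<in>verts T. vmap \<iota> n \<noteq> n"
proof (rule ccontr)
  assume "\<not> ?thesis"
  then have fix_v: "\<And>n. n \<in> verts T \<Longrightarrow> vmap \<iota> n = n" by blast
  have "amap \<iota> a = a" if "a \<in> arcs T" for a
    using retr_arc[OF that] that fix_v by (auto intro: out_arc_unique)
  with fix_v have "qeq T \<iota> qid" by (simp add: qeq_def qid_def)
  with retr show False by (simp add: retraction_def)
qed

lemma retr_sim: "n \<in> verts T \<Longrightarrow> sim n (vmap \<iota> n)"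
proof (coinduction arbitrary: n)
  case sim
  have "\<exists>y. y \<in> verts T \<and> y \<noteq> root \<and> par y = vmap \<iota> n \<and> label y = label x \<and>
      (\<exists>n. x = n \<and> y = vmap \<iota> n \<and> n \<in> verts T)"
    if "x \<in> verts T" "x \<noteq> root" "par x = n" for x
    using that retr_in_verts retr_nonroot by blast
  then show ?case by auto
qed

text \<open>At a moved vertex of least depth the parent is fixed, so that the vertex and its image
  are siblings.\<close>

lemma retr_fold_pair: "\<exists>n. fold_pair n (vmap \<iota> n)"
proof -
  obtain k where "k \<in> verts T \<and> vmap \<iota> k \<noteq> k" using retr_moves by blast
  from ex_has_least_nat[of "\<lambda>n. n \<in> verts T \<and> vmap \<iota> n \<noteq> n", OF this, of depth]
  obtain n where n: "n \<in> verts T" "vmap \<iota> n \<noteq> n"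
    and min: "\<And>m. m \<in> verts T \<Longrightarrow> vmap \<iota> m \<noteq> m \<Longrightarrow> depth n \<le> depth m"
    by blast
  have nr: "n \<noteq> root" using n retr_root by auto
  have "vmap \<iota> (par n) = par n"
    using min[of "par n"] depth_parent[OF n(1) nr] parent_in_verts[OF n(1) nr] by fastforce
  then have "fold_pair n (vmap \<iota> n)"
    using n nr retr_nonroot[OF n(1) nr] retr_in_verts by (auto simp: fold_pair_def)
  then show ?thesis ..
qed

end

lemma retraction_imp_fold: "retraction \<iota> \<Longrightarrow> \<exists>n m. fold_pair n m \<and> sim n m"
  using retr_fold_pair retr_sim by (meson fold_pair_def)

text \<open>
  Conversely, a map of the subtree above \<open>n\<close> to the disjoint subtree above a sibling \<open>m\<close>, extended by
  the identity, is idempotent.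
\<close>

context
  fixes n m assumes fold: "fold_pair n m" and sim_nm: "sim n m"
begin

text \<open>Recursion along parents. A vertex other than \<open>n\<close> with fixed parent stays
  fixed; once the parent has moved, the vertex goes to a child of the new parent chosen by means of
  \<open>sim\<close>. Thus only vertices above \<open>n\<close> can move.\<close>

function retract :: "'n \<Rightarrow> 'n" where
  "retract x =
     (if x = n then m
      else if x \<notin> verts T \<or> x = root then x
      else if retract (par x) = par x then x
      else SOME z. z \<in> verts T \<and> z \<noteq> root \<and> par z = retract (par x) \<and> label z = label x \<and> sim x z)"
  by auto
termination
  by (relation "measure depth") (auto simp: depth_parent)

declare retract.simps [simp del]

lemma retract_root: "retract root = root"
  using fold by (subst retract.simps) (auto simp: fold_pair_def)

text \<open>The depth statements are part of the invariant because they show that \<open>n\<close>,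
  the one vertex moved despite its fixed parent, is never an image. This gives idempotence.\<close>

lemma retract_props:
  assumes "x \<in> verts T"
  shows "retract x = x \<or>
    retract x \<in> verts T \<and> x \<noteq> root \<and> retract x \<noteq> root \<and> par (retract x) = retract (par x) \<and>
    label (retract x) = label x \<and> sim x (retract x) \<and> depth n \<le> depth x \<and>
    depth (retract x) = depth x \<and> retract (retract x) = retract x"
  using assms
proof (induction rule: vertex_induct)
  case root
  then show ?case by (simp add: retract_root)
next
  case (step x)
  have n: "n \<in> verts T" "m \<in> verts T" "n \<noteq> root" "m \<noteq> root" "n \<noteq> m" "par n = par m" "label n = label m"
    using fold by (auto simp: fold_pair_def)
  note dx = depth_parent[OF step(1,2)] parent_in_verts[OF step(1,2)]
  note dn = depth_parent[OF n(1,3)]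
  have dm: "depth m = depth n" using dn depth_parent[OF n(2,4)] n(6) by simp
  show ?case
  proof (cases "x = n")
    case True
    have "\<not> depth n \<le> depth (par n)" using dn by simp
    then have "retract (par n) = par n" using step(3) True by blast
    moreover have "retract n = m" by (simp add: retract.simps)
    moreover have "retract m = m" using calculation(1) n by (simp add: retract.simps[of m])
    ultimately show ?thesis using True n sim_nm dm by simp
  next
    case xn: False
    show ?thesis
    proof (cases "retract (par x) = par x")
      case True
      then show ?thesis using xn step(1,2) by (simp add: retract.simps[of x])
    next
      case False
      then have IH: "retract (par x) \<in> verts T" "sim (par x) (retract (par x))" "depth n \<le> depth (par x)"
        "depth (retract (par x)) = depth (par x)" "retract (retract (par x)) = retract (par x)"
        using step(3) by auto
      define z where "z = (SOME z. z \<in> verts T \<and> z \<noteq> root \<and> par z = retract (par x) \<and>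
        label z = label x \<and> sim x z)"
      have "\<exists>z. z \<in> verts T \<and> z \<noteq> root \<and> par z = retract (par x) \<and> label z = label x \<and> sim x z"
        using simE[OF IH(2) step(1,2) refl] by metis
      from someI_ex[OF this, folded z_def]
      have z: "z \<in> verts T" "z \<noteq> root" "par z = retract (par x)" "label z = label x" "sim x z" by auto
      have rx: "retract x = z" using xn False step(1,2) by (simp add: retract.simps[of x] z_def)
      have dz: "depth z = depth x" using depth_parent[OF z(1,2)] z(3) IH(4) dx by simp
      \<comment> \<open>The parent of \<open>x\<close> has moved and so has depth at least
        \<open>depth n\<close>; hence \<open>x\<close> and \<open>z\<close> lie strictly deeper than
        \<open>n\<close>.\<close>
      have "z \<noteq> n" using dz dx IH(3) by auto
      then have "retract z = z" using z IH(5) by (simp add: retract.simps[of z])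
      then show ?thesis using rx z step(2) dz IH(3) dx by simp
    qed
  qed
qed

lemma fold_imp_retraction: "\<exists>\<iota>. retraction \<iota>"
proof -
  define \<iota> where "\<iota> = \<lparr>vmap = retract, amap = \<lambda>a. out_arc T (retract (tail T a))\<rparr>"
  have verts: "retract x \<in> verts T" if "x \<in> verts T" for x
    using retract_props[OF that] that by auto
  have idem: "retract (retract x) = retract x" if "x \<in> verts T" for x
    using retract_props[OF that] by auto
  have nonroot: "retract x \<noteq> root \<and> par (retract x) = retract (par x) \<and> label (retract x) = label x"
    if x: "x \<in> verts T" "x \<noteq> root" for x
  proof (cases "retract x = x")
    case True
    \<comment> \<open>A fixed vertex has a fixed parent, since otherwise the last clause of
      \<open>retract\<close> picks its image above \<open>retract (par x)\<close>.\<close>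
    have "retract (par x) = par x"
    proof (rule ccontr)
      assume ne: "retract (par x) \<noteq> par x"
      then have "depth n \<le> depth (par x)" using retract_props parent_in_verts[OF x] by blast
      then have "x \<noteq> n" using depth_parent[OF x] by auto
      have "\<exists>z. z \<in> verts T \<and> z \<noteq> root \<and> par z = retract (par x) \<and> label z = label x \<and> sim x z"
        using simE[of "par x" "retract (par x)" x] ne retract_props[OF parent_in_verts[OF x]] x by metis
      from someI_ex[OF this] have "par (retract x) = retract (par x)"
        using \<open>x \<noteq> n\<close> ne x by (simp add: retract.simps[of x])
      then show False using True ne by simp
    qed
    then show ?thesis using True x by simp
  next
    case False
    then show ?thesis using retract_props[OF x(1)] by auto
  qed
  have arc: "out_arc T (retract (tail T a)) \<in> arcs T"
    "tail T (out_arc T (retract (tail T a))) = retract (tail T a)"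
    "head T (out_arc T (retract (tail T a))) = retract (head T a)"
    "amap F (out_arc T (retract (tail T a))) = amap F a"
    if a: "a \<in> arcs T" for a
  proof -
    have t: "tail T a \<in> verts T" "tail T a \<noteq> root" using a tail_neq_root by auto
    note nr = nonroot[OF t] verts[OF t(1)]
    show "out_arc T (retract (tail T a)) \<in> arcs T"
      "tail T (out_arc T (retract (tail T a))) = retract (tail T a)"
      using nr by (auto intro: out_arc_props)
    show "head T (out_arc T (retract (tail T a))) = retract (head T a)"
      using nr a by (simp add: parent_def)
    show "amap F (out_arc T (retract (tail T a))) = amap F a" using nr a by simp
  qed
  have "vmap F (retract x) = vmap F x" if "x \<in> verts T" for x
  proof (cases "x = root")
    case True
    then show ?thesis by (simp add: retract_root)
  next
    case False
    then show ?thesis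
      using label_props(2)[OF that False] label_props(2)[OF verts[OF that]] nonroot[OF that False] by simp
  qed
  moreover have "\<not> qeq T \<iota> qid"
    using fold by (auto simp: qeq_def qid_def \<iota>_def fold_pair_def retract.simps[of n] intro!: bexI[of _ n])
  ultimately have "retraction \<iota>"
    using verts idem arc by (auto simp: retraction_def quiver_morphism_def qeq_def qcomp_def \<iota>_def)
  then show ?thesis ..
qed

end

lemma retraction_iff_fold: "(\<exists>\<iota>. retraction \<iota>) \<longleftrightarrow> (\<exists>n m. fold_pair n m \<and> sim n m)"
  using retraction_imp_fold fold_imp_retraction by blast

end

section \<open>Generalized graph maps\<close>

lemma covering_network_simps [simp]:
  "verts (quiver (covering_network N)) = verts (quiver N) \<times> {-1, 1}"
  "arcs (quiver (covering_network N)) = arcs (quiver N) \<times> {-1, 1}"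
  "tail (quiver (covering_network N)) = map_prod (tail (quiver N)) id"
  "head (quiver (covering_network N)) = map_prod (head (quiver N)) id"
  by (simp_all add: covering_network_def)

lemma pullback_network_simps [simp]:
  "verts (quiver (pullback_network T1 F1 T2 F2)) =
     {(n, m). n \<in> verts T1 \<and> m \<in> verts T2 \<and> vmap F1 n = vmap F2 m}"
  "arcs (quiver (pullback_network T1 F1 T2 F2)) =
     {(a, b). a \<in> arcs T1 \<and> b \<in> arcs T2 \<and> amap F1 a = amap F2 b}"
  "tail (quiver (pullback_network T1 F1 T2 F2)) = map_prod (tail T1) (tail T2)"
  "head (quiver (pullback_network T1 F1 T2 F2)) = map_prod (head T1) (head T2)"
  by (simp_all add: pullback_network_def)

section \<open>Comparison of generalized graph maps with folds and idempotents\<close>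

context tree_over
begin

text \<open>Part (i) of completeness lifts an arrow into \<open>n\<close> to an equally labelled
  arrow into \<open>m\<close> on the same sheet \<open>j\<close>, so the pairs on one sheet form a
  relation as in the definition of \<open>sim\<close>.\<close>

lemma ggm_imp_sim:
  assumes M: "generalized_graph_map T F T F M" and nm: "(n, m) \<in> fst ` verts (quiver M)"
  shows "sim n m"
proof -
  have sub: "subnetwork M (covering_network (pullback_network T F T F))"
    and compl: "complete_network T T F M"
    using M by (simp_all add: generalized_graph_map_def)
  interpret M: wf_digraph "quiver M" using sub by (simp add: subnetwork_def wf_network_def)
  have tl: "tail (quiver M) = map_prod (map_prod (tail T) (tail T)) id"
    and arcsM: "arcs (quiver M) \<subseteq> {(a, b). a \<in> arcs T \<and> b \<in> arcs T \<and> amap F a = amap F b} \<times> {-1, 1}"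
    using sub by (simp_all add: subnetwork_def subgraph_def compatible_def)
  obtain j where "((n, m), j) \<in> verts (quiver M)" using nm by auto
  then show ?thesis
  proof (coinduction arbitrary: n m)
    case sim
    have "\<exists>y. y \<in> verts T \<and> y \<noteq> root \<and> par y = m \<and> label y = label x \<and> ((x, y), j) \<in> verts (quiver M)"
      if x: "x \<in> verts T" "x \<noteq> root" "par x = n" for x
    proof -
      let ?a = "out_arc T x"
      note a = out_arc_props[OF x(1,2)]
      have "head T ?a = n" using x(3) by (simp add: parent_def)
      then obtain b where b: "b \<in> arcs T" "head T b = m" "((?a, b), j) \<in> arcs (quiver M)"
        using compl sim a(1) unfolding complete_network_def by blast
      then have "((x, tail T b), j) \<in> verts (quiver M)"
        using M.tail_in_verts[OF b(3)] a(2) by (simp add: tl)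
      moreover have "label (tail T b) = label x" using b arcsM by auto
      ultimately show ?thesis using b tail_neq_root by (intro exI[of _ "tail T b"]) auto
    qed
    then show ?case by blast
  qed
qed

lemma pullback_wf: "wf_digraph (quiver (pullback_network T F T F))"
  using morphism by unfold_locales (auto simp: quiver_morphism_def, metis+)

lemma covering_wf: "wf_digraph (quiver (covering_network (pullback_network T F T F)))"
  using pullback_wf by (auto simp: wf_digraph_def)

text \<open>
  In the pullback network, edges preserve the first coordinate and every vertex has at most one
  outgoing arrow, so that three vertices on the graph of a function span at most two links.
\<close>

lemma no_triangle_on_graph:
  assumes S: "\<And>p. p \<in> S \<Longrightarrow> snd p = f (fst p)"
  shows "\<not> triangle (pullback_network T F T F) S"
proof
  let ?N = "pullback_network T F T F"
  assume tri: "triangle ?N S"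
  define A where "A = {b \<in> arcs (quiver ?N). tail (quiver ?N) b \<in> S \<and> head (quiver ?N) b \<in> S}"
  have SV: "fst p \<in> verts T" if "p \<in> S" for p using tri that by (auto simp: triangle_def)
  have card: "card S = 3" and finS: "finite S"
    using tri by (auto simp: triangle_def intro: card_ge_0_finite)
  have "e \<notin> edges ?N" if e: "e \<subseteq> S" for e
  proof
    assume "e \<in> edges ?N"
    then obtain n m m' where "e = {(n, m), (n, m')}" "m \<noteq> m'"
      by (auto simp: pullback_network_def)
    then show False using S[of "(n, m)"] S[of "(n, m')"] e by auto
  qed
  then have no_edges: "{e \<in> edges ?N. e \<subseteq> S} = {}" by blast
  have "S \<noteq> {}" using card by auto
  \<comment> \<open>Arrows lower the depth of the first coordinate, so a pair where it is least is
    not the tail of an arrow inside \<open>S\<close>. The other two vertices are tails of at most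
    one arrow each.\<close>
  then obtain p where p: "p \<in> S" "\<And>q. q \<in> S \<Longrightarrow> depth (fst p) \<le> depth (fst q)"
    using ex_has_least_nat[of "\<lambda>p. p \<in> S" _ "\<lambda>p. depth (fst p)"] by blast
  have tails: "tail (quiver ?N) ` A \<subseteq> S - {p}"
  proof
    fix q assume "q \<in> tail (quiver ?N) ` A"
    then obtain a b where ab: "a \<in> arcs T" "q = (tail T a, tail T b)" "q \<in> S" "(head T a, head T b) \<in> S"
      by (auto simp: A_def)
    then show "q \<in> S - {p}" using p(2)[OF ab(4)] depth_tail[OF ab(1)] by auto
  qed
  have "inj_on (tail (quiver ?N)) A"
    by (auto simp: inj_on_def A_def intro: out_arc_unique)
  then have "card A \<le> card (S - {p})" using card_inj_on_le tails finS by blast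
  moreover have "card (S - {p}) = 2" using p(1) card by simp
  ultimately show False using tri no_edges unfolding triangle_def A_def by simp
qed

text \<open>The network is the graph of \<iota> on the sheet \<open>1\<close>, with the arrows
  \<open>(a, amap \<iota> a)\<close> and no edges. Part (ii) of completeness holds by its first
  alternative, because the only arrow leaving \<open>vmap \<iota> n\<close> is the image of the one
  leaving \<open>n\<close>.\<close>

lemma retraction_imp_ggm:
  assumes retr: "retraction \<iota>"
  shows "\<exists>M n m. generalized_graph_map T F T F M \<and> (n, m) \<in> fst ` verts (quiver M) \<and> fold_pair n m"
proof -
  let ?N = "pullback_network T F T F"
  let ?C = "covering_network ?N"
  let ?f = "vmap \<iota>"
  define D where "D = \<lparr>verts = (\<lambda>x. ((x, ?f x), 1)) ` verts T, arcs = (\<lambda>a. ((a, amap \<iota> a), 1)) ` arcs T,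
    tail = tail (quiver ?C), head = head (quiver ?C)\<rparr>"
  define M where "M = \<lparr>quiver = D, edges = {}\<rparr>"
  note rs = retr_in_verts[OF retr] retr_vmap[OF retr] retr_arc[OF retr]
  have wfD: "wf_digraph D" by unfold_locales (auto simp: D_def rs)
  then have wfM: "wf_network M" by (simp add: wf_network_def M_def)
  have sub: "subnetwork M ?C"
    using wfM wfD covering_wf by (auto simp: subnetwork_def subgraph_def compatible_def M_def D_def rs)
  have compl: "complete_network T T F M"
    unfolding complete_network_def
  proof (intro allI impI conjI ballI)
    fix n m j a assume nm: "((n, m), j) \<in> verts (quiver M)" and a: "a \<in> arcs T" "head T a = n"
    then show "\<exists>b\<in>arcs T. head T b = m \<and> ((a, b), j) \<in> arcs (quiver M)"
      by (intro bexI[of _ "amap \<iota> a"]) (auto simp: M_def D_def rs)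
  next
    fix n m j b assume nm: "((n, m), j) \<in> verts (quiver M)" and b: "b \<in> arcs T" "tail T b = m"
    have n: "n \<in> verts T" "m = ?f n" "j = 1" using nm by (auto simp: M_def D_def)
    \<comment> \<open>The root is fixed by \<iota>, and no arrow leaves it.\<close>
    have nr: "n \<noteq> root" using b n retr_root[OF retr] tail_neq_root by auto
    let ?a = "out_arc T n"
    note a = out_arc_props[OF n(1) nr]
    have "amap \<iota> ?a = b" using a b n by (intro out_arc_unique) (simp_all add: rs)
    then have "((?a, b), j) \<in> arcs (quiver M)" using a n by (auto simp: M_def D_def)
    with a show "(\<exists>a\<in>arcs T. tail T a = n \<and> ((a, b), j) \<in> arcs (quiver M)) \<or>
       (\<exists>b''\<in>arcs T. head T b'' = head T b \<and> amap F b = amap F b'' \<and>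
           ((n, tail T b''), -j) \<in> verts (quiver M) \<and>
           {((n, m), j), ((n, tail T b''), -j)} \<in> edges M)" by blast
  qed
  define R where "R = (\<lambda>u v. \<exists>l. step M u l v)"
  \<comment> \<open>Connectedness goes through the pair over the root, reached by passing to
    parents.\<close>
  have down: "R\<^sup>*\<^sup>* ((x, ?f x), 1) ((root, ?f root), 1) \<and> R\<^sup>*\<^sup>* ((root, ?f root), 1) ((x, ?f x), 1)"
    if "x \<in> verts T" for x
    using that
  proof (induction rule: vertex_induct)
    case (step x)
    let ?b = "((out_arc T x, amap \<iota> (out_arc T x)), 1)"
    note a = out_arc_props[OF step(1,2)]
    have "step M ((x, ?f x), 1) (Arr ?b) ((par x, ?f (par x)), 1)"
      "step M ((par x, ?f (par x)), 1) (Inv ?b) ((x, ?f x), 1)"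
      using a by (auto simp: M_def D_def rs parent_def)
    then have "R ((x, ?f x), 1) ((par x, ?f (par x)), 1)"
      "R ((par x, ?f (par x)), 1) ((x, ?f x), 1)" unfolding R_def by blast+
    with step.IH show ?case
      by (meson converse_rtranclp_into_rtranclp rtranclp.rtrancl_into_rtrancl)
  qed simp
  have conn: "network_connected M"
    unfolding network_connected_def
  proof (intro ballI)
    fix u v assume uv: "u \<in> verts (quiver M)" "v \<in> verts (quiver M)"
    then have "R\<^sup>*\<^sup>* u v" using down by (auto simp: M_def D_def intro: rtranclp_trans)
    with uv(2) show "\<exists>t. traversal M t \<and> hd (fst t) = u \<and> last (fst t) = v"
      unfolding R_def by (intro reachable_imp_traversal[OF wfM])
  qed
  have R2: "R2_free ?N M"
    unfolding R2_free_def R2_def R1_def walk_proj_def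
  proof (intro allI impI notI)
    fix t assume t: "traversal M t"
    then have "set (fst t) \<subseteq> verts (quiver M)" by (auto simp: traversal_def walk_def)
    then have "\<not> triangle ?N (set (map fst (fst t)))"
      by (intro no_triangle_on_graph[of _ ?f]) (auto simp: M_def D_def)
    moreover assume "t \<in> {t. traversal ?C t \<and> (map fst (fst t), map link_proj (snd t)) \<in>
      {t. traversal ?N t \<and> length (snd t) = 2 \<and> triangle ?N (set (fst t))}}"
    ultimately show False by simp
  qed
  have inv: "involution_free M" by (auto simp: involution_free_def M_def D_def)
  have "((root, ?f root), 1) \<in> verts (quiver M)" by (simp add: M_def D_def)
  then have "verts (quiver M) \<noteq> {}" by blast
  with sub compl conn R2 inv have "generalized_graph_map T F T F M"
    by (simp add: generalized_graph_map_def)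
  moreover obtain n where n: "fold_pair n (?f n)" using retr_fold_pair[OF retr] by blast
  moreover have "(n, ?f n) \<in> fst ` verts (quiver M)"
    using n by (force simp: fold_pair_def M_def D_def)
  ultimately show ?thesis by blast
qed

lemma retraction_iff_ggm:
  "(\<exists>\<iota>. retraction \<iota>) \<longleftrightarrow>
   (\<exists>M n m. generalized_graph_map T F T F M \<and> (n, m) \<in> fst ` verts (quiver M) \<and> fold_pair n m)"
  using retraction_imp_ggm ggm_imp_sim retraction_iff_fold by blast

end

section \<open>Linear extension and rooted tree modules\<close>

interpretation pm: vector_space "pm_scale :: 'k::field \<Rightarrow> ('i \<Rightarrow>\<^sub>0 'k) \<Rightarrow> ('i \<Rightarrow>\<^sub>0 'k)"
  by (rule vector_space_pm_scale)

text \<open>The linear map that sends the basis vector at \<open>n\<close> to \<open>g n\<close>; a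
  family \<open>g\<close> plays the role of its matrix.\<close>

definition lin_ext :: "('i \<Rightarrow> 'j \<Rightarrow>\<^sub>0 'k::field) \<Rightarrow> ('i \<Rightarrow>\<^sub>0 'k) \<Rightarrow> ('j \<Rightarrow>\<^sub>0 'k)" where
  "lin_ext g f = (\<Sum>n\<in>Poly_Mapping.keys f. pm_scale (Poly_Mapping.lookup f n) (g n))"

text \<open>A common finite index set makes sums over different supports comparable.\<close>

lemma lin_ext_superset:
  "finite S \<Longrightarrow> Poly_Mapping.keys f \<subseteq> S \<Longrightarrow>
   lin_ext g f = (\<Sum>n\<in>S. pm_scale (Poly_Mapping.lookup f n) (g n))"
  unfolding lin_ext_def by (rule sum.mono_neutral_left) (simp_all add: in_keys_iff)

lemma lin_ext_cong: "(\<And>n. n \<in> Poly_Mapping.keys f \<Longrightarrow> g n = h n) \<Longrightarrow> lin_ext g f = lin_ext h f"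
  by (simp add: lin_ext_def)

lemma lin_ext_zero [simp]: "lin_ext g 0 = 0"
  by (simp add: lin_ext_def)

lemma lin_ext_single [simp]: "lin_ext g (Poly_Mapping.single n 1) = g n"
  by (simp add: lin_ext_def)

lemma lin_ext_add: "lin_ext g (f + h) = lin_ext g f + lin_ext g h"
proof -
  let ?S = "Poly_Mapping.keys f \<union> Poly_Mapping.keys h"
  have "Poly_Mapping.keys (f + h) \<subseteq> ?S" by (rule Poly_Mapping.keys_add)
  then show ?thesis
    by (simp add: lin_ext_superset[of ?S] lookup_add pm.scale_left_distrib sum.distrib)
qed

lemma lin_ext_scale: "lin_ext g (pm_scale c f) = pm_scale c (lin_ext g f)"
proof -
  have "Poly_Mapping.keys (pm_scale c f) \<subseteq> Poly_Mapping.keys f" by (auto simp: in_keys_iff)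
  then show ?thesis
    by (simp add: lin_ext_superset[of "Poly_Mapping.keys f"] pm.scale_sum_right)
qed

lemma lin_ext_diff: "lin_ext g (f - h) = lin_ext g f - lin_ext g h"
  using lin_ext_add[of g "f - h" h] by simp

lemma lin_ext_diff_fun: "lin_ext (\<lambda>n. g n - h n) f = lin_ext g f - lin_ext h f"
  by (simp add: lin_ext_def pm.scale_right_diff_distrib sum_subtractf)

lemma lin_ext_sum: "lin_ext g (\<Sum>i\<in>A. h i) = (\<Sum>i\<in>A. lin_ext g (h i))"
  by (induction A rule: infinite_finite_induct) (simp_all add: lin_ext_add)

lemma lin_ext_lin_ext: "lin_ext h (lin_ext g f) = lin_ext (\<lambda>n. lin_ext h (g n)) f"
  unfolding lin_ext_def[of g] by (simp add: lin_ext_sum lin_ext_scale) (simp add: lin_ext_def)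

lemma lookup_lin_ext:
  assumes "finite S" "Poly_Mapping.keys f \<subseteq> S"
  shows "Poly_Mapping.lookup (lin_ext g f) i =
    (\<Sum>n\<in>S. Poly_Mapping.lookup f n * Poly_Mapping.lookup (g n) i)"
  by (simp add: lin_ext_superset[OF assms] lookup_sum)

lemma lin_ext_id [simp]: "lin_ext (\<lambda>n. Poly_Mapping.single n 1) f = f"
  by (rule poly_mapping_eqI)
    (simp add: lookup_lin_ext[OF finite_keys order_refl] lookup_single when_def in_keys_iff
      if_distrib[of "(*) _"] cong: if_cong)

lemma lin_ext_in_subspace:
  assumes "pm.subspace X" "\<And>n. n \<in> Poly_Mapping.keys f \<Longrightarrow> g n \<in> X"
  shows "lin_ext g f \<in> X"
  unfolding lin_ext_def using assms by (intro pm.subspace_sum pm.subspace_scale)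

lemma single_one_neq_zero [simp]: "Poly_Mapping.single n (1::'k::field) \<noteq> 0"
  by (metis lookup_single_eq lookup_zero zero_neq_one)

lemma scale_rtm [simp]: "scale (rtm T F) = pm_scale"
  by (simp add: rtm_def)

text \<open>Every vector is the combination of the basis vectors in its support, which turns
  membership in the span into a condition on keys.\<close>

lemma space_rtm_iff:
  "f \<in> space (rtm T F) x \<longleftrightarrow> Poly_Mapping.keys f \<subseteq> {n \<in> verts T. vmap F n = x}"
proof
  assume "f \<in> space (rtm T F) x"
  then show "Poly_Mapping.keys f \<subseteq> {n \<in> verts T. vmap F n = x}"
    using keys_span[of f "{n \<in> verts T. vmap F n = x}"] by (simp add: rtm_def)
next
  assume "Poly_Mapping.keys f \<subseteq> {n \<in> verts T. vmap F n = x}"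
  then have "lin_ext (\<lambda>n. Poly_Mapping.single n 1) f \<in> space (rtm T F) x"
    by (intro lin_ext_in_subspace) (auto simp: rtm_def intro!: pm.span_base)
  then show "f \<in> space (rtm T F) x" by simp
qed

lemma subspace_space_rtm: "pm.subspace (space (rtm T F) x)"
  by (simp add: rtm_def)

section \<open>Action of the arrows, and decompositions from idempotents of the tree\<close>

context tree_over
begin

text \<open>The image of a basis vector under \<gamma>: at most one arrow leaves \<open>n\<close>,
  so the sum in \<open>rtm\<close> has at most one term.\<close>

definition arrow :: "'e \<Rightarrow> 'n \<Rightarrow> 'n \<Rightarrow>\<^sub>0 'k::field" where
  "arrow \<gamma> n = (if n \<in> verts T \<and> n \<noteq> root \<and> label n = \<gamma> then Poly_Mapping.single (par n) 1 else 0)"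

lemma act_rtm: "act (rtm T F :: ('k::field, _, _, _) rep) \<gamma> = lin_ext (arrow \<gamma>)"
proof -
  have "(\<Sum>a\<in>{a \<in> arcs T. tail T a = n \<and> amap F a = \<gamma>}. Poly_Mapping.single (head T a) (1::'k)) = arrow \<gamma> n" for n
  proof (cases "n \<in> verts T \<and> n \<noteq> root \<and> label n = \<gamma>")
    case True
    then have a: "out_arc T n \<in> arcs T" "tail T (out_arc T n) = n" using out_arc_props by simp_all
    have "{a \<in> arcs T. tail T a = n \<and> amap F a = \<gamma>} = {out_arc T n}"
    proof (intro equalityI subsetI)
      fix b assume "b \<in> {a \<in> arcs T. tail T a = n \<and> amap F a = \<gamma>}"
      then show "b \<in> {out_arc T n}" using out_arc_tail[of b] by simp
    qed (use a True in simp)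
    then show ?thesis using True by (simp add: arrow_def parent_def)
  next
    case False
    have "a \<notin> arcs T" if "tail T a = n" "amap F a = \<gamma>" for a
      using False tail_neq_root[of a] out_arc_tail[of a] tail_in_verts[of a] that by auto
    then have "{a \<in> arcs T. tail T a = n \<and> amap F a = \<gamma>} = {}" by blast
    then have "(\<Sum>a\<in>{a \<in> arcs T. tail T a = n \<and> amap F a = \<gamma>}. Poly_Mapping.single (head T a) (1::'k)) = 0"
      by (simp only: sum.empty)
    then show ?thesis using False by (auto simp: arrow_def)
  qed
  then show ?thesis by (simp add: rtm_def lin_ext_def fun_eq_iff)
qed

lemma single_in_space: "n \<in> verts T \<Longrightarrow> Poly_Mapping.single n 1 \<in> space (rtm T F) (vmap F n)"
  by (simp add: space_rtm_iff)

lemma nonzero_space_rtm: "nonzero_family Q (space (rtm T F :: ('k::field, _, _, _) rep))"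
proof -
  have "Poly_Mapping.single root (1::'k) \<in> space (rtm T F) (vmap F root)"
    by (rule single_in_space) simp
  moreover have "Poly_Mapping.single root (1::'k) \<noteq> 0" by simp
  ultimately show ?thesis unfolding nonzero_family_def using vmap_in_verts root_in_verts by blast
qed

lemma act_rtm_space:
  assumes "\<gamma> \<in> arcs Q" "f \<in> space (rtm T F) (tail Q \<gamma>)"
  shows "act (rtm T F) \<gamma> f \<in> space (rtm T F) (head Q \<gamma>)"
  unfolding act_rtm
proof (intro lin_ext_in_subspace subspace_space_rtm)
  fix n assume "n \<in> Poly_Mapping.keys f"
  show "arrow \<gamma> n \<in> space (rtm T F) (head Q \<gamma>)"
  proof (cases "n \<in> verts T \<and> n \<noteq> root \<and> label n = \<gamma>")
    case True
    then show ?thesis using parent_in_verts label_props(3)[of n] by (simp add: arrow_def space_rtm_iff)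
  next
    case False
    then show ?thesis unfolding arrow_def using pm.subspace_0[OF subspace_space_rtm] by auto
  qed
qed

text \<open>The induced endomorphism \<phi> commutes with the action because \<iota> preserves
  parents and labels. As \<phi> is idempotent, the module is the direct sum of its fixed vectors
  \<open>U\<close> and its kernel \<open>W\<close>; the basis vector at the root witnesses that
  \<open>U\<close> is nonzero.\<close>

lemma retraction_imp_decomposable:
  assumes retr: "retraction \<iota>"
  shows "\<not> indecomposable Q (rtm T F :: ('k::field, _, _, _) rep)"
proof -
  let ?M = "rtm T F :: ('k, 'n \<Rightarrow>\<^sub>0 'k, 'v, 'e) rep"
  define \<phi> where "\<phi> = lin_ext (\<lambda>n. Poly_Mapping.single (vmap \<iota> n) (1::'k))"
  define U where "U = (\<lambda>x. {f \<in> space ?M x. \<phi> f = f})"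
  define W where "W = (\<lambda>x. {f \<in> space ?M x. \<phi> f = 0})"
  note rs = retr_in_verts[OF retr] retr_vmap[OF retr] retr_idem[OF retr]
  have phi_add: "\<phi> (f + g) = \<phi> f + \<phi> g" and phi_diff: "\<phi> (f - g) = \<phi> f - \<phi> g"
    and phi_scale: "\<phi> (pm_scale c f) = pm_scale c (\<phi> f)" and phi_0: "\<phi> 0 = 0" for f g c
    by (simp_all add: \<phi>_def lin_ext_add lin_ext_scale lin_ext_diff)
  have phi_space: "\<phi> f \<in> space ?M x" if "f \<in> space ?M x" for f x
    unfolding \<phi>_def using that
    by (intro lin_ext_in_subspace subspace_space_rtm) (auto simp: space_rtm_iff rs)
  have phi_idem: "\<phi> (\<phi> f) = \<phi> f" if "f \<in> space ?M x" for f x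
    unfolding \<phi>_def lin_ext_lin_ext using that
    by (intro lin_ext_cong) (auto simp: space_rtm_iff rs)
  have phi_act: "\<phi> (act ?M \<gamma> f) = act ?M \<gamma> (\<phi> f)" if "f \<in> space ?M x" for f x \<gamma>
    unfolding \<phi>_def act_rtm lin_ext_lin_ext
  proof (rule lin_ext_cong)
    fix n assume "n \<in> Poly_Mapping.keys f"
    then have n: "n \<in> verts T" using that by (auto simp: space_rtm_iff)
    show "lin_ext (\<lambda>n. Poly_Mapping.single (vmap \<iota> n) (1::'k)) (arrow \<gamma> n) =
      lin_ext (arrow \<gamma>) (Poly_Mapping.single (vmap \<iota> n) 1)"
      using n rs retr_nonroot[OF retr n] retr_root[OF retr]
      by (cases "n = root") (auto simp: arrow_def)
  qed
  note sp = pm.subspace_0[OF subspace_space_rtm] pm.subspace_add[OF subspace_space_rtm]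
    pm.subspace_scale[OF subspace_space_rtm]
  have act_zero: "act ?M \<gamma> 0 = 0" for \<gamma> by (simp add: act_rtm)
  have "pm.subspace (U x)" "pm.subspace (W x)" for x
    unfolding U_def W_def using sp
    by (auto intro!: pm.subspaceI simp: phi_add phi_scale phi_0)
  moreover have "act ?M \<gamma> f \<in> U (head Q \<gamma>)" if "\<gamma> \<in> arcs Q" "f \<in> U (tail Q \<gamma>)" for \<gamma> f
    using that act_rtm_space[of \<gamma> f] phi_act[of f "tail Q \<gamma>" \<gamma>] by (simp add: U_def)
  moreover have "act ?M \<gamma> f \<in> W (head Q \<gamma>)" if "\<gamma> \<in> arcs Q" "f \<in> W (tail Q \<gamma>)" for \<gamma> f
    using that act_rtm_space[of \<gamma> f] phi_act[of f "tail Q \<gamma>" \<gamma>] act_zero by (simp add: W_def)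
  moreover have "U x \<subseteq> space ?M x" "W x \<subseteq> space ?M x" for x by (auto simp: U_def W_def)
  ultimately have "subrep Q ?M U" "subrep Q ?M W" by (simp_all add: subrep_def)
  moreover have "direct_sum Q ?M U W"
    unfolding direct_sum_def
  proof (intro ballI conjI)
    fix x
    show "U x \<inter> W x = {0}"
      using pm.subspace_0[OF subspace_space_rtm] by (auto simp: U_def W_def phi_0)
    show "space ?M x = {u + w |u w. u \<in> U x \<and> w \<in> W x}" (is "_ = ?R")
    proof (intro equalityI subsetI)
      fix f assume f: "f \<in> space ?M x"
      have "\<phi> f \<in> U x" "f - \<phi> f \<in> W x"
        using f phi_space[OF f] phi_idem[OF f] pm.subspace_diff[OF subspace_space_rtm f phi_space[OF f]]
        by (auto simp: U_def W_def phi_diff)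
      then show "f \<in> ?R" by (intro CollectI exI[of _ "\<phi> f"] exI[of _ "f - \<phi> f"]) simp
    qed (auto simp: U_def W_def intro: pm.subspace_add[OF subspace_space_rtm])
  qed
  moreover have "nonzero_family Q U"
  proof -
    have "Poly_Mapping.single root 1 \<in> U (vmap F root)"
      unfolding U_def using single_in_space[of root] by (simp add: \<phi>_def retr_root[OF retr])
    moreover have "Poly_Mapping.single root (1::'k) \<noteq> 0" by simp
    ultimately show ?thesis unfolding nonzero_family_def using vmap_in_verts root_in_verts by blast
  qed
  moreover have "nonzero_family Q W"
  proof -
    obtain n where n: "n \<in> verts T" "vmap \<iota> n \<noteq> n" using retr_moves[OF retr] by blast
    \<comment> \<open>Idempotence of \<iota> puts this difference into the kernel; its coordinate at
      the moved vertex \<open>n\<close> is \<open>1\<close>.\<close>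
    let ?f = "Poly_Mapping.single n (1::'k) - Poly_Mapping.single (vmap \<iota> n) 1"
    have "Poly_Mapping.single (vmap \<iota> n) (1::'k) \<in> space ?M (vmap F n)"
      using n rs by (simp add: space_rtm_iff)
    then have "?f \<in> W (vmap F n)"
      unfolding W_def using n rs single_in_space[OF n(1)] pm.subspace_diff[OF subspace_space_rtm]
      by (simp add: phi_diff) (simp add: \<phi>_def)
    moreover have "?f \<noteq> 0"
    proof
      assume "?f = 0"
      then have "Poly_Mapping.lookup ?f n = 0" by simp
      then show False using n(2) by (simp add: lookup_minus lookup_single when_def)
    qed
    ultimately show ?thesis unfolding nonzero_family_def using vmap_in_verts n(1) by blast
  qed
  ultimately show ?thesis unfolding indecomposable_def by blast
qed

end


section \<open>Decompositions\<close>

text \<open>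
  \<open>u n\<close> is the component in \<open>U\<close> of the basis vector at \<open>n\<close> with respect to \<open>M = U \<oplus> W\<close>, and \<open>coef\<close>
  the matrix of the projection onto \<open>U\<close>.
\<close>

locale splitting = tree_over T Q F
  for T :: "('n, 'a) pre_digraph" and Q :: "('v, 'e) pre_digraph" and F :: "('n, 'a, 'v, 'e) quiver_map" +
  fixes U W :: "'v \<Rightarrow> ('n \<Rightarrow>\<^sub>0 'k::field) set" and u :: "'n \<Rightarrow> 'n \<Rightarrow>\<^sub>0 'k"
  assumes subrep_U: "subrep Q (rtm T F) U" and subrep_W: "subrep Q (rtm T F) W"
    and disjoint: "x \<in> verts Q \<Longrightarrow> U x \<inter> W x = {0}"
    and u_in: "n \<in> verts T \<Longrightarrow> u n \<in> U (vmap F n)"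
    and w_in: "n \<in> verts T \<Longrightarrow> Poly_Mapping.single n 1 - u n \<in> W (vmap F n)"
begin

abbreviation coef :: "'n \<Rightarrow> 'n \<Rightarrow> 'k" where "coef n m \<equiv> Poly_Mapping.lookup (u n) m"

lemma subspace_UW: "x \<in> verts Q \<Longrightarrow> pm.subspace (U x)" "x \<in> verts Q \<Longrightarrow> pm.subspace (W x)"
  using subrep_U subrep_W by (simp_all add: subrep_def)

text \<open>The difference of two candidates for the component in \<open>U x\<close> lies in
  \<open>W x\<close> as well.\<close>

lemma component_unique:
  assumes x: "x \<in> verts Q" and "a \<in> U x" "f - a \<in> W x" "a' \<in> U x" "f - a' \<in> W x"
  shows "a = a'"
proof -
  have "a - a' \<in> U x" using assms pm.subspace_diff[OF subspace_UW(1)[OF x]] by blast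
  moreover have "(f - a') - (f - a) \<in> W x" using assms pm.subspace_diff[OF subspace_UW(2)[OF x]] by blast
  then have "a - a' \<in> W x" by simp
  ultimately have "a - a' \<in> {0}" using disjoint[OF x] by blast
  then show ?thesis by simp
qed

lemma keys_u: "n \<in> verts T \<Longrightarrow> Poly_Mapping.keys (u n) \<subseteq> {m \<in> verts T. vmap F m = vmap F n}"
  using u_in[of n] vmap_in_verts[of n] subrep_U space_rtm_iff[of "u n" T F "vmap F n"]
  unfolding subrep_def by blast

lemma coef_nonzero:
  assumes "n \<in> verts T" "coef n m \<noteq> 0"
  shows "m \<in> verts T" "vmap F m = vmap F n"
  using keys_u[OF assms(1)] assms(2) by (auto simp: in_keys_iff)

text \<open>Thus \<open>lin_ext u\<close> is the projection onto \<open>U\<close> along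
  \<open>W\<close>: by linearity it suffices to know this on basis vectors.\<close>

lemma projection:
  assumes x: "x \<in> verts Q" and f: "f \<in> space (rtm T F) x"
  shows "lin_ext u f \<in> U x" "f - lin_ext u f \<in> W x"
proof -
  have k: "n \<in> verts T \<and> vmap F n = x" if "n \<in> Poly_Mapping.keys f" for n
    using that f by (auto simp: space_rtm_iff)
  show "lin_ext u f \<in> U x"
    using k u_in by (intro lin_ext_in_subspace subspace_UW x) auto
  have "lin_ext (\<lambda>n. Poly_Mapping.single n 1 - u n) f \<in> W x"
    using k w_in by (intro lin_ext_in_subspace subspace_UW x) auto
  then show "f - lin_ext u f \<in> W x" by (simp add: lin_ext_diff_fun)
qed

lemma projection_U:
  assumes x: "x \<in> verts Q" and f: "f \<in> U x"
  shows "lin_ext u f = f"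
proof (rule component_unique[OF x])
  have "f \<in> space (rtm T F) x" using subrep_U x f by (auto simp: subrep_def)
  then show "lin_ext u f \<in> U x" "f - lin_ext u f \<in> W x" by (rule projection[OF x])+
  show "f - f \<in> W x" using pm.subspace_0[OF subspace_UW(2)[OF x]] by simp
qed (rule f)

text \<open>The projection fixes \<open>u n\<close>, a vector of \<open>U\<close>; in coordinates
  this says that the matrix is idempotent.\<close>

lemma coef_idem:
  assumes "n \<in> verts T"
  shows "coef n k = (\<Sum>m\<in>verts T. coef n m * coef m k)"
proof -
  have "coef n k = Poly_Mapping.lookup (lin_ext u (u n)) k"
    using projection_U[OF vmap_in_verts u_in] assms by simp
  also have "\<dots> = (\<Sum>m\<in>verts T. coef n m * coef m k)"
    by (rule lookup_lin_ext) (use keys_u[OF assms] in auto)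
  finally show ?thesis .
qed

text \<open>Since \<gamma> preserves \<open>U\<close> and \<open>W\<close>, both sides are the
  component in \<open>U\<close> of the image of the basis vector at \<open>n\<close>.\<close>

lemma act_u:
  assumes n: "n \<in> verts T" and \<gamma>: "\<gamma> \<in> arcs Q" "tail Q \<gamma> = vmap F n" and Q: "head Q \<gamma> \<in> verts Q"
  shows "lin_ext (arrow \<gamma>) (u n) = (if n \<noteq> root \<and> label n = \<gamma> then u (par n) else 0)"
proof (rule component_unique[OF Q, of _ "arrow \<gamma> n"])
  show "lin_ext (arrow \<gamma>) (u n) \<in> U (head Q \<gamma>)"
    using subrep_U \<gamma> u_in[OF n] unfolding subrep_def act_rtm by metis
  have "lin_ext (arrow \<gamma>) (Poly_Mapping.single n 1 - u n) \<in> W (head Q \<gamma>)"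
    using subrep_W \<gamma> w_in[OF n] unfolding subrep_def act_rtm by metis
  then show "arrow \<gamma> n - lin_ext (arrow \<gamma>) (u n) \<in> W (head Q \<gamma>)" by (simp add: lin_ext_diff)
  have "(if n \<noteq> root \<and> label n = \<gamma> then u (par n) else 0) \<in> U (head Q \<gamma>) \<and>
    arrow \<gamma> n - (if n \<noteq> root \<and> label n = \<gamma> then u (par n) else 0) \<in> W (head Q \<gamma>)"
  proof (cases "n \<noteq> root \<and> label n = \<gamma>")
    case True
    then have "par n \<in> verts T" "head Q \<gamma> = vmap F (par n)"
      using parent_in_verts label_props[of n] n by auto
    then show ?thesis using True n u_in[of "par n"] w_in[of "par n"] by (simp add: arrow_def)
  next
    case False
    then show ?thesis
      using pm.subspace_0[OF subspace_UW(1)[OF Q]] pm.subspace_0[OF subspace_UW(2)[OF Q]]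
      by (auto simp: arrow_def)
  qed
  then show "(if n \<noteq> root \<and> label n = \<gamma> then u (par n) else 0) \<in> U (head Q \<gamma>)"
    "arrow \<gamma> n - (if n \<noteq> root \<and> label n = \<gamma> then u (par n) else 0) \<in> W (head Q \<gamma>)" by blast+
qed

text \<open>This is coordinate \<open>i\<close> of \<open>act_u\<close>: only the children of
  \<open>i\<close> with label \<gamma> are sent to \<open>i\<close>.\<close>

lemma coef_act:
  assumes n: "n \<in> verts T" and \<gamma>: "\<gamma> \<in> arcs Q" "tail Q \<gamma> = vmap F n" and Q: "head Q \<gamma> \<in> verts Q"
  shows "(\<Sum>m\<in>{m \<in> verts T. m \<noteq> root \<and> par m = i \<and> label m = \<gamma>}. coef n m) =
    (if n \<noteq> root \<and> label n = \<gamma> then coef (par n) i else 0)"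
proof -
  have "(\<Sum>m\<in>{m \<in> verts T. m \<noteq> root \<and> par m = i \<and> label m = \<gamma>}. coef n m) =
    (\<Sum>m\<in>verts T. if m \<noteq> root \<and> par m = i \<and> label m = \<gamma> then coef n m else 0)"
    by (rule sum.inter_filter) simp
  also have "\<dots> = (\<Sum>m\<in>verts T. coef n m * Poly_Mapping.lookup (arrow \<gamma> m) i)"
    by (intro sum.cong) (auto simp: arrow_def lookup_single when_def)
  also have "\<dots> = Poly_Mapping.lookup (lin_ext (arrow \<gamma>) (u n)) i"
    by (rule lookup_lin_ext[symmetric]) (use keys_u[OF n] in auto)
  finally show ?thesis by (simp add: act_u[OF assms])
qed

lemma head_label_in_verts: "n \<in> verts T \<Longrightarrow> n \<noteq> root \<Longrightarrow> head Q (label n) \<in> verts Q"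
  by (simp add: label_props parent_in_verts vmap_in_verts)

text \<open>For a child \<open>x\<close> of \<open>n\<close>, the entries \<open>coef x y\<close>
  over the children \<open>y\<close> of \<open>m\<close> with the label of \<open>x\<close> add up
  to \<open>coef n m\<close>, so one of them is nonzero.\<close>

lemma coef_sim:
  assumes "n \<in> verts T" "coef n m \<noteq> 0"
  shows "sim n m"
proof (rule sim_coinductI[of "\<lambda>n m. n \<in> verts T \<and> coef n m \<noteq> 0"])
  fix n m x assume nm: "n \<in> verts T \<and> coef n m \<noteq> 0" and x: "x \<in> verts T" "x \<noteq> root" "par x = n"
  have "(\<Sum>y\<in>{y \<in> verts T. y \<noteq> root \<and> par y = m \<and> label y = label x}. coef x y) \<noteq> 0"
    using coef_act[OF x(1) label_props(1,2)[OF x(1,2)] head_label_in_verts[OF x(1,2)], of m] x nm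
    by simp
  then obtain y where "y \<in> {y \<in> verts T. y \<noteq> root \<and> par y = m \<and> label y = label x}"
    "coef x y \<noteq> 0" by (rule sum.not_neutral_contains_not_neutral)
  then show "\<exists>y. y \<in> verts T \<and> y \<noteq> root \<and> par y = m \<and> label y = label x \<and> x \<in> verts T \<and> coef x y \<noteq> 0"
    using x(1) by (intro exI[of _ y]) simp
next
  show "n \<in> verts T \<and> coef n m \<noteq> 0" using assms by (rule conjI)
qed

lemma coef_root:
  assumes "coef root m \<noteq> 0"
  shows "m = root"
  by (rule sim_root[OF coef_sim[OF root_in_verts assms] coef_nonzero(1)[OF root_in_verts assms]])

text \<open>The row of the root has no entry off the diagonal, so idempotence makes the diagonal
  entry equal to its square.\<close>

lemma coef_root_root: "coef root root \<in> {0, 1}"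
proof -
  have "coef root root = (\<Sum>m\<in>verts T. coef root m * coef m root)" by (rule coef_idem[OF root_in_verts])
  also have "\<dots> = (\<Sum>m\<in>{root}. coef root m * coef m root)"
  proof (rule sum.mono_neutral_right)
    have "coef root m = 0" if "m \<noteq> root" for m using coef_root[of m] that by blast
    then show "\<forall>m\<in>verts T - {root}. coef root m * coef m root = 0" by simp
  qed simp_all
  finally show ?thesis by simp
qed

text \<open>A nonzero entry \<open>coef n y\<close> gives \<open>sim n y\<close> and thus
  \<open>sim m y\<close>. Without folds no sibling \<open>y\<close> of \<open>m\<close> with the
  same label satisfies this, and the sum in \<open>coef_act\<close> reduces to
  \<open>coef n m\<close>.\<close>

lemma coef_parent:
  assumes no_fold: "\<And>n m. fold_pair n m \<Longrightarrow> \<not> sim n m"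
    and n: "n \<in> verts T" and c: "coef n m \<noteq> 0" and s: "sim m n" and m: "m \<noteq> root"
  shows "n \<noteq> root" "coef (par n) (par m) \<noteq> 0"
proof -
  have mv: "m \<in> verts T" "vmap F m = vmap F n" using coef_nonzero[OF n c] by auto
  let ?S = "{y \<in> verts T. y \<noteq> root \<and> par y = par m \<and> label y = label m}"
  have "coef n y = 0" if "y \<in> ?S - {m}" for y
  proof (rule ccontr)
    assume "coef n y \<noteq> 0"
    then have "sim m y" using coef_sim[OF n] sim_trans[OF s] by blast
    moreover have "fold_pair m y" using that mv m by (auto simp: fold_pair_def)
    ultimately show False using no_fold by blast
  qed
  then have "sum (coef n) ?S = sum (coef n) {m}"
    using mv m by (intro sum.mono_neutral_right ballI) simp_all
  moreover have "sum (coef n) ?S = (if n \<noteq> root \<and> label n = label m then coef (par n) (par m) else 0)"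
    using label_props[OF mv(1) m] mv head_label_in_verts[OF mv(1) m] by (intro coef_act n) auto
  ultimately have "(if n \<noteq> root \<and> label n = label m then coef (par n) (par m) else 0) \<noteq> 0"
    using c by simp
  then show "n \<noteq> root" "coef (par n) (par m) \<noteq> 0" by (auto split: if_splits)
qed

text \<open>
  The support of an idempotent matrix is a dense relation, hence empty as soon as it is acyclic.
  A cycle of the support consists of vertices that are equivalent under \<open>sim\<close>, so that by
  \<open>coef_parent\<close> it descends to a cycle through the parents, and finally to one through the root.
\<close>

lemma trivial_summand:
  assumes no_fold: "\<And>n m. fold_pair n m \<Longrightarrow> \<not> sim n m" and root0: "coef root root = 0"
  shows "\<not> nonzero_family Q U"
proof -
  define R where "R = {(n, m). n \<in> verts T \<and> coef n m \<noteq> 0}"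
  have R_root: "(root, m) \<notin> R" for m using coef_root[of m] root0 by (auto simp: R_def)
  have R_verts: "R \<subseteq> verts T \<times> verts T" using coef_nonzero by (auto simp: R_def)
  have R_sim: "sim n m" if "(n, m) \<in> R\<^sup>+" for n m
    using that by (induction rule: trancl_induct) (auto simp: R_def intro: coef_sim sim_trans)
  have R_par: "(par n, par m) \<in> R" if "(n, m) \<in> R" "sim m n" "m \<noteq> root" for n m
    using that coef_parent[OF no_fold] parent_in_verts by (auto simp: R_def)
  \<comment> \<open>The assumption \<open>sim m n\<close> closes the chain up to \<open>sim\<close>,
    so all its vertices are equivalent and \<open>R_par\<close> applies to each link. Intermediate
    vertices differ from the root because the row of the root is empty.\<close>
  have R_par_trancl: "(par n, par m) \<in> R\<^sup>+" if "(n, m) \<in> R\<^sup>+" "sim m n" "m \<noteq> root" for n m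
    using that
  proof (induction rule: trancl_induct)
    case (base m)
    then show ?case using R_par by blast
  next
    case (step m k)
    have "sim m n" using step.hyps(2) step.prems(1) R_sim sim_trans by blast
    moreover have "m \<noteq> root" using step.hyps(2) R_root by blast
    ultimately have "(par n, par m) \<in> R\<^sup>+" by (rule step.IH)
    moreover have "sim k m" using step.hyps(1) step.prems(1) R_sim sim_trans by blast
    then have "(par m, par k) \<in> R" using R_par step.hyps(2) step.prems(2) by blast
    ultimately show ?case by (rule trancl_into_trancl)
  qed
  have "(n, n) \<notin> R\<^sup>+" if "n \<in> verts T" for n
    using that
  proof (induction rule: vertex_induct)
    case root
    then show ?case using R_root by (meson tranclD)
  next
    case (step n)
    then show ?case using R_par_trancl sim_refl by blast
  qed
  moreover have "n \<in> verts T" if "(n, n) \<in> R\<^sup>+" for n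
    using that R_verts by (meson SigmaD1 subsetD tranclD)
  ultimately have "acyclic R" by (auto simp: acyclic_def)
  moreover have "finite R" using R_verts by (rule finite_subset) simp
  ultimately have "wf (R\<inverse>)" by (intro finite_acyclic_wf_converse)
  \<comment> \<open>By idempotence a pair \<open>(n, m)\<close> of the support factors through some
    \<open>k\<close>; the induction hypothesis for the successor \<open>k\<close> of
    \<open>n\<close> rules out \<open>(k, m)\<close>.\<close>
  then have R_empty: "(n, m) \<notin> R" for n m
  proof (induction n arbitrary: m rule: wf_induct_rule)
    case (less n)
    show ?case
    proof
      assume "(n, m) \<in> R"
      then have n: "n \<in> verts T" and "(\<Sum>k\<in>verts T. coef n k * coef k m) \<noteq> 0"
        using coef_idem[of n m] by (simp_all add: R_def)
      from this(2) obtain k where "k \<in> verts T" "coef n k * coef k m \<noteq> 0"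
        by (rule sum.not_neutral_contains_not_neutral)
      then have "(n, k) \<in> R" "(k, m) \<in> R" using n by (auto simp: R_def)
      then show False using less by blast
    qed
  qed
  then have u0: "u n = 0" if "n \<in> verts T" for n
    using that by (intro poly_mapping_eqI) (auto simp: R_def)
  have "f = 0" if x: "x \<in> verts Q" and f: "f \<in> U x" for x f
  proof -
    have "Poly_Mapping.keys f \<subseteq> verts T"
      using subrep_U x f space_rtm_iff[of f T F x] by (auto simp: subrep_def)
    then have "lin_ext u f = lin_ext (\<lambda>_. 0) f" using u0 by (intro lin_ext_cong) auto
    then show ?thesis using projection_U[OF x f] by (simp add: lin_ext_def)
  qed
  then show ?thesis
    using pm.subspace_0[OF subspace_UW(1)] by (fastforce simp: nonzero_family_def)
qed

end

section \<open>Indecomposability in the absence of folds\<close>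

context tree_over
begin

text \<open>The situation is symmetric in \<open>U\<close> and \<open>W\<close>, whose projections
  add up to the identity. Their diagonal entries at the root are \<open>0\<close> or
  \<open>1\<close> with sum \<open>1\<close>, so one of them vanishes and
  \<open>trivial_summand\<close> kills the corresponding summand.\<close>

lemma no_fold_imp_indecomposable:
  assumes no_fold: "\<And>n m. fold_pair n m \<Longrightarrow> \<not> sim n m"
  shows "indecomposable Q (rtm T F :: ('k::field, _, _, _) rep)"
proof -
  let ?M = "rtm T F :: ('k, 'n \<Rightarrow>\<^sub>0 'k, 'v, 'e) rep"
  have False
    if sub: "subrep Q ?M U" "subrep Q ?M W" and ds: "direct_sum Q ?M U W"
      and nz: "nonzero_family Q U" "nonzero_family Q W" for U W
  proof -
    have "\<exists>u. u \<in> U (vmap F n) \<and> Poly_Mapping.single n 1 - u \<in> W (vmap F n)" if n: "n \<in> verts T" for n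
    proof -
      have "Poly_Mapping.single n 1 \<in> {u + w |u w. u \<in> U (vmap F n) \<and> w \<in> W (vmap F n)}"
        using ds single_in_space[OF n] vmap_in_verts[OF n] unfolding direct_sum_def by blast
      then show ?thesis by auto
    qed
    then obtain u where u: "\<And>n. n \<in> verts T \<Longrightarrow> u n \<in> U (vmap F n)"
      "\<And>n. n \<in> verts T \<Longrightarrow> Poly_Mapping.single n 1 - u n \<in> W (vmap F n)" by metis
    have dj: "U x \<inter> W x = {0}" "W x \<inter> U x = {0}" if "x \<in> verts Q" for x
      using ds that unfolding direct_sum_def by blast+
    have U: "splitting T Q F U W u"
      using sub dj u by (intro splitting.intro tree_over_axioms splitting_axioms.intro)
    have ww: "Poly_Mapping.single n 1 - (Poly_Mapping.single n 1 - u n) \<in> U (vmap F n)"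
      if "n \<in> verts T" for n using u(1)[OF that] by simp
    have W: "splitting T Q F W U (\<lambda>n. Poly_Mapping.single n 1 - u n)"
      using sub dj u(2) ww by (intro splitting.intro tree_over_axioms splitting_axioms.intro)
    have "Poly_Mapping.lookup (u root) root = 0 \<or>
        Poly_Mapping.lookup (Poly_Mapping.single root 1 - u root) root = 0"
      using splitting.coef_root_root[OF U] by (auto simp: lookup_minus)
    then show False
      using splitting.trivial_summand[OF U no_fold] splitting.trivial_summand[OF W no_fold] nz by blast
  qed
  then show ?thesis unfolding indecomposable_def using nonzero_space_rtm by blast
qed

end


section \<open>Characterization of indecomposability\<close>

theorem theorem3p1:
  fixes Q :: "('v, 'e) pre_digraph"
    and \<rho> :: "('v, 'e) qpath set"
    and T :: "('n, 'a) pre_digraph"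
    and F :: "('n, 'a, 'v, 'e) quiver_map"
  assumes "CHAR('k::field) \<noteq> 2"
    and "bound_quiver TYPE('k) Q \<rho>"
    and "rooted_tree T"
    and "bound_morphism TYPE('k) T Q \<rho> F"
  shows "(indecomposable Q (rtm T F :: ('k, 'n \<Rightarrow>\<^sub>0 'k, 'v, 'e) rep) \<longleftrightarrow>
          \<not> (\<exists>\<iota>. quiver_morphism T T \<iota> \<and> qeq T (qcomp \<iota> \<iota>) \<iota> \<and> \<not> qeq T \<iota> qid \<and>
                 qeq T (qcomp F \<iota>) F)) \<and>
         (\<not> (\<exists>\<iota>. quiver_morphism T T \<iota> \<and> qeq T (qcomp \<iota> \<iota>) \<iota> \<and> \<not> qeq T \<iota> qid \<and>
                 qeq T (qcomp F \<iota>) F) \<longleftrightarrow>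
          \<not> (\<exists>M n1 n2. generalized_graph_map T F T F M \<and> (n1, n2) \<in> fst ` verts (quiver M) \<and>
                 n1 \<noteq> n2 \<and> n1 \<noteq> tree_root T \<and> n2 \<noteq> tree_root T \<and> parent T n1 = parent T n2 \<and>
                 amap F (out_arc T n1) = amap F (out_arc T n2)))"
proof -
  have "fin_digraph T" using assms(3) by (simp add: rooted_tree_def tree_quiver_def)
  then have rt: "root_tree T" using assms(3) by (intro root_tree.intro root_tree_axioms.intro)
  have "quiver_morphism T Q F" using assms(4) by (simp add: bound_morphism_def)
  with rt interpret tree_over T Q F by (intro tree_over.intro tree_over_axioms.intro)
  have "indecomposable Q (rtm T F :: ('k, 'n \<Rightarrow>\<^sub>0 'k, 'v, 'e) rep) \<longleftrightarrow> \<not> (\<exists>\<iota>. retraction \<iota>)"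
    using retraction_imp_decomposable no_fold_imp_indecomposable retraction_iff_fold by blast
  moreover have "(\<exists>M n1 n2. generalized_graph_map T F T F M \<and> (n1, n2) \<in> fst ` verts (quiver M) \<and>
      n1 \<noteq> n2 \<and> n1 \<noteq> root \<and> n2 \<noteq> root \<and> par n1 = par n2 \<and> label n1 = label n2) \<longleftrightarrow>
    (\<exists>M n1 n2. generalized_graph_map T F T F M \<and> (n1, n2) \<in> fst ` verts (quiver M) \<and> fold_pair n1 n2)"
  proof -
    \<comment> \<open>Only membership in \<open>T\<close> separates the condition in (3) from
      \<open>fold_pair\<close>, and it holds for the coordinates of every vertex of the
      network.\<close>
    have "n1 \<in> verts T \<and> n2 \<in> verts T"
      if "generalized_graph_map T F T F M" "(n1, n2) \<in> fst ` verts (quiver M)" for M n1 n2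
      using that by (auto simp: generalized_graph_map_def subnetwork_def subgraph_def)
    then show ?thesis unfolding fold_pair_def by meson
  qed
  ultimately show ?thesis
    unfolding retraction_iff_ggm[symmetric] retraction_def[symmetric] by (simp only: simp_thms)
qed

end
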